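(* Let $K$ be any field and $\mathbf R=\operatorname{Lie}(v_0,v_1)$. The components of the $\mathbb Z^2$-gradation $\mathbf R=\bigoplus_{n_1,n_2\ge 0}\mathbf R_{n_1,n_2}$ by multidegree in the generators $\{v_0,v_1\}$ are at most one-dimensional.
   Context: Let $\Lambda=\Lambda(x_i\mid i\ge 0)$ be the Grassmann (exterior) algebra over $K$ on odd generators $x_0,x_1,\dots$, a $\mathbb Z_2$-graded algebra. In $\operatorname{End}\Lambda$ identify $x_i$ with left multiplication by $x_i$, and let $\partial_i$ be the odd superderivation of $\Lambda$ with $\partial_i(x_j)=\delta_{ij}$. The supercommutator is $[a,b]=ab-(-1)^{\deg a\deg b}ba$. The pivot elements are the odd superderivations $v_i=\partial_i+x_ix_{i+1}(\partial_{i+2}+x_{i+2}x_{i+3}(\partial_{i+4}+\cdots))$, $i\ge 0$, that is, $v_i=\partial_i+x_ix_{i+1}v_{i+2}$ (well defined on $\Lambda$, since each element involves finitely many letters). $\mathbf R=\operatorname{Lie}(v_0,v_1)$ is the smallest $\mathbb Z_2$-graded subspace of $\operatorname{End}\Lambda$ containing $v_0,v_1$, closed under the supercommutator and, if $\operatorname{char}K=2$, also under $a\mapsto a^2$ for odd elements $a$. $\mathbf R_{n_1,n_2}$ is the span of the Lie monomials containing $n_1$ factors $v_0$ and $n_2$ factors $v_1$ (if $\operatorname{char}K=2$, including squares of odd Lie monomials, a square doubling the multidegree); $\mathbf R$ is the direct sum of these components. *)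

theory Defs
  imports Complex_Main "HOL-Library.Function_Algebras" "HOL-Library.Product_Plus"
begin

section \<open>The Grassmann algebra on countably many odd generators\<close>

text \<open>
  For a finite set \<open>S = {s\<^sub>1 < \<dots> < s\<^sub>m}\<close> of indices let \<open>e\<^sub>S = x\<^bsub>s\<^sub>1\<^esub> \<cdots> x\<^bsub>s\<^sub>m\<^esub>\<close>.  An element of the
  algebra is represented by its family of coefficients with respect to the basis \<open>(e\<^sub>S)\<close>.
\<close>

typedef (overloaded) 'k grassmann =
  "{f :: nat set \<Rightarrow> 'k::field. finite {S. f S \<noteq> 0} \<and> (\<forall>S. f S \<noteq> 0 \<longrightarrow> finite S)}"
  morphisms coeff Abs_grassmann
  by (rule exI[of _ "\<lambda>_. 0"]) auto

lemma finite_supp: "finite {S. coeff f S \<noteq> 0}"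
  using coeff[of f] by simp

lemma coeff_infinite: "infinite S \<Longrightarrow> coeff f S = 0"
  using coeff[of f] by blast

lemma grassmann_eqI:
  assumes "\<And>S. finite S \<Longrightarrow> coeff f S = coeff g S"
  shows "f = g"
proof -
  have "coeff f S = coeff g S" for S
    by (cases "finite S") (simp_all only: assms coeff_infinite not_False_eq_True)
  then show ?thesis
    by (intro coeff_inject[THEN iffD1] ext)
qed

lemma coeff_Abs:
  assumes "finite {S. f S \<noteq> 0}" "\<And>S. infinite S \<Longrightarrow> f S = 0"
  shows "coeff (Abs_grassmann f) = f"
  using assms by (intro Abs_grassmann_inverse) auto

text \<open>\<open>e\<^sub>S e\<^sub>T = grassmann_sign S T e\<^bsub>S \<union> T\<^esub>\<close> for disjoint \<open>S\<close> and \<open>T\<close>.\<close>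

definition grassmann_sign :: "nat set \<Rightarrow> nat set \<Rightarrow> 'k::field" where
  "grassmann_sign S T = (-1) ^ card {(s, t). s \<in> S \<and> t \<in> T \<and> t < s}"

definition grassmann_scale :: "'k::field \<Rightarrow> 'k grassmann \<Rightarrow> 'k grassmann" where
  "grassmann_scale c f = Abs_grassmann (\<lambda>S. c * coeff f S)"

definition grassmann_basis :: "nat set \<Rightarrow> 'k::field grassmann" where
  "grassmann_basis S = Abs_grassmann (\<lambda>T. if finite S \<and> T = S then 1 else 0)"

definition gen :: "nat \<Rightarrow> 'k::field grassmann" where
  "gen i = grassmann_basis {i}"

instantiation grassmann :: (field) "{zero, one, plus, minus, uminus, times}"
begin

definition "0 = Abs_grassmann (\<lambda>_. 0)"
definition "1 = grassmann_basis {}"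
definition "f + g = Abs_grassmann (\<lambda>S. coeff f S + coeff g S)"
definition "f - g = Abs_grassmann (\<lambda>S. coeff f S - coeff g S)"
definition "- f = Abs_grassmann (\<lambda>S. - coeff f S)"
definition "f * g = Abs_grassmann
  (\<lambda>U. if finite U then \<Sum>S\<in>Pow U. grassmann_sign S (U - S) * coeff f S * coeff g (U - S) else 0)"

instance ..

end

lemma coeff_zero [simp]: "coeff 0 S = 0"
  by (simp add: zero_grassmann_def coeff_Abs)

lemma coeff_basis: "coeff (grassmann_basis S) T = (if finite S \<and> T = S then 1 else 0)"
  unfolding grassmann_basis_def
  by (subst coeff_Abs) (auto intro: finite_subset[of _ "{S}"])

lemma coeff_one: "coeff 1 S = (if S = {} then 1 else 0)"
  by (simp add: one_grassmann_def coeff_basis)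

lemma coeff_add [simp]: "coeff (f + g) S = coeff f S + coeff g S"
  unfolding plus_grassmann_def
  by (subst coeff_Abs)
     (auto simp: coeff_infinite
       intro: finite_subset[OF _ finite_UnI[OF finite_supp[of f] finite_supp[of g]]])

lemma coeff_diff [simp]: "coeff (f - g) S = coeff f S - coeff g S"
  unfolding minus_grassmann_def
  by (subst coeff_Abs)
     (auto simp: coeff_infinite
       intro: finite_subset[OF _ finite_UnI[OF finite_supp[of f] finite_supp[of g]]])

lemma coeff_uminus [simp]: "coeff (- f) S = - coeff f S"
  unfolding uminus_grassmann_def by (subst coeff_Abs) (auto simp: coeff_infinite finite_supp)

lemma coeff_scale [simp]: "coeff (grassmann_scale c f) S = c * coeff f S"
  unfolding grassmann_scale_def
  by (subst coeff_Abs)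
     (auto simp: coeff_infinite intro: finite_subset[OF _ finite_supp[of f]])

lemma coeff_mult:
  assumes "finite U"
  shows "coeff (f * g) U = (\<Sum>S\<in>Pow U. grassmann_sign S (U - S) * coeff f S * coeff g (U - S))"
proof -
  let ?h = "\<lambda>U. if finite U
    then \<Sum>S\<in>Pow U. grassmann_sign S (U - S) * coeff f S * coeff g (U - S) else 0"
  have "{U. ?h U \<noteq> 0} \<subseteq> (\<lambda>(S, T). S \<union> T) ` ({S. coeff f S \<noteq> 0} \<times> {S. coeff g S \<noteq> 0})"
  proof
    fix U assume "U \<in> {U. ?h U \<noteq> 0}"
    then have "(\<Sum>S\<in>Pow U. grassmann_sign S (U - S) * coeff f S * coeff g (U - S)) \<noteq> 0"
      by (simp split: if_splits)
    then obtain S where "S \<in> Pow U" "grassmann_sign S (U - S) * coeff f S * coeff g (U - S) \<noteq> 0"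
      by (meson sum.neutral)
    then show "U \<in> (\<lambda>(S, T). S \<union> T) ` ({S. coeff f S \<noteq> 0} \<times> {S. coeff g S \<noteq> 0})"
      by (intro image_eqI[of _ _ "(S, U - S)"]) auto
  qed
  then have "finite {U. ?h U \<noteq> 0}"
    by (rule finite_subset) (intro finite_imageI finite_cartesian_product finite_supp)
  then have "coeff (Abs_grassmann ?h) = ?h"
    by (intro coeff_Abs) auto
  then have "coeff (f * g) U = ?h U"
    by (simp only: times_grassmann_def)
  with assms show ?thesis
    by (simp only: if_True)
qed


instance grassmann :: (field) ab_group_add
proof
  fix f g h :: "'a grassmann"
  show "f + g + h = f + (g + h)" by (rule grassmann_eqI) (simp add: add.assoc)
  show "f + g = g + f" by (rule grassmann_eqI) (simp add: add.commute)
  show "0 + f = f" by (rule grassmann_eqI) simp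
  show "- f + f = 0" by (rule grassmann_eqI) simp
  show "f - g = f + - g" by (rule grassmann_eqI) simp
qed

lemma grassmann_sign_empty [simp]: "grassmann_sign {} T = 1" "grassmann_sign S {} = 1"
  by (simp_all add: grassmann_sign_def)

lemma grassmann_sign_Un_left:
  assumes "finite S" "finite T" "finite U" "S \<inter> T = {}"
  shows "grassmann_sign (S \<union> T) U = (grassmann_sign S U * grassmann_sign T U :: 'k::field)"
proof -
  have eq: "{(s, t). s \<in> S \<union> T \<and> t \<in> U \<and> t < s} =
      {(s, t). s \<in> S \<and> t \<in> U \<and> t < s} \<union> {(s, t). s \<in> T \<and> t \<in> U \<and> t < s}"
    by auto
  have fin: "finite {(s, t). s \<in> S \<and> t \<in> U \<and> t < s}" "finite {(s, t). s \<in> T \<and> t \<in> U \<and> t < s}"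
    by (rule finite_subset[of _ "S \<times> U"], use assms in auto)
       (rule finite_subset[of _ "T \<times> U"], use assms in auto)
  show ?thesis
    unfolding grassmann_sign_def eq power_add[symmetric]
    by (subst card_Un_disjoint) (use fin assms in auto)
qed

lemma grassmann_sign_Un_right:
  assumes "finite S" "finite T" "finite U" "T \<inter> U = {}"
  shows "grassmann_sign S (T \<union> U) = (grassmann_sign S T * grassmann_sign S U :: 'k::field)"
proof -
  have eq: "{(s, t). s \<in> S \<and> t \<in> T \<union> U \<and> t < s} =
      {(s, t). s \<in> S \<and> t \<in> T \<and> t < s} \<union> {(s, t). s \<in> S \<and> t \<in> U \<and> t < s}"
    by auto
  have fin: "finite {(s, t). s \<in> S \<and> t \<in> T \<and> t < s}" "finite {(s, t). s \<in> S \<and> t \<in> U \<and> t < s}"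
    by (rule finite_subset[of _ "S \<times> T"], use assms in auto)
       (rule finite_subset[of _ "S \<times> U"], use assms in auto)
  show ?thesis
    unfolding grassmann_sign_def eq power_add[symmetric]
    by (subst card_Un_disjoint) (use fin assms in auto)
qed

lemma grassmann_mult_assoc: "f * g * h = f * (g * (h :: 'k::field grassmann))"
proof (rule grassmann_eqI)
  fix U :: "nat set" assume U: "finite U"
  have "coeff (f * g * h) U = (\<Sum>T\<in>Pow U. \<Sum>S\<in>Pow T.
      grassmann_sign T (U - T) * grassmann_sign S (T - S) *
      (coeff f S * coeff g (T - S) * coeff h (U - T)))"
    unfolding coeff_mult[OF U]
    by (intro sum.cong refl)
       (subst coeff_mult, use U in \<open>auto intro: finite_subset simp: sum_distrib_left sum_distrib_right mult_ac\<close>)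
  also have "\<dots> = (\<Sum>(T, S)\<in>(SIGMA T:Pow U. Pow T).
      grassmann_sign T (U - T) * grassmann_sign S (T - S) *
      (coeff f S * coeff g (T - S) * coeff h (U - T)))"
    using U by (intro sum.Sigma) (auto intro: finite_subset)
  also have "\<dots> = (\<Sum>(S, R)\<in>(SIGMA S:Pow U. Pow (U - S)).
      grassmann_sign S (U - S) * grassmann_sign R (U - S - R) *
      (coeff f S * coeff g R * coeff h (U - S - R)))"
  proof (rule sum.reindex_bij_witness[of _ "\<lambda>(S, R). (S \<union> R, S)" "\<lambda>(T, S). (S, T - S)"])
    fix p assume "p \<in> (SIGMA T:Pow U. Pow T)"
    then obtain T S where p: "p = (T, S)" and sub: "S \<subseteq> T" "T \<subseteq> U" by auto
    have fin: "finite S" "finite T" "finite (T - S)" "finite (U - T)"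
      using sub U by (auto intro: finite_subset)
    have 1: "U - S - (T - S) = U - T" using sub by auto
    have 2: "grassmann_sign T (U - T) =
        (grassmann_sign S (U - T) * grassmann_sign (T - S) (U - T) :: 'k)"
      using grassmann_sign_Un_left[of S "T - S" "U - T"] fin sub by (simp add: Un_absorb1)
    have "U - S = (T - S) \<union> (U - T)" using sub by auto
    then have 3: "grassmann_sign S (U - S) =
        (grassmann_sign S (T - S) * grassmann_sign S (U - T) :: 'k)"
      using grassmann_sign_Un_right[of S "T - S" "U - T"] fin sub by auto
    show "(case case p of (T, S) \<Rightarrow> (S, T - S) of (S, R) \<Rightarrow>
        grassmann_sign S (U - S) * grassmann_sign R (U - S - R) *
        (coeff f S * coeff g R * coeff h (U - S - R))) =
      (case p of (T, S) \<Rightarrow> grassmann_sign T (U - T) * grassmann_sign S (T - S) *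
        (coeff f S * coeff g (T - S) * coeff h (U - T)))"
      by (simp add: p 1 2 3)
  qed auto
  also have "\<dots> = (\<Sum>S\<in>Pow U. \<Sum>R\<in>Pow (U - S).
      grassmann_sign S (U - S) * grassmann_sign R (U - S - R) *
      (coeff f S * coeff g R * coeff h (U - S - R)))"
    using U by (intro sum.Sigma[symmetric]) auto
  also have "\<dots> = coeff (f * (g * h)) U"
    unfolding coeff_mult[OF U]
    by (intro sum.cong refl)
       (subst coeff_mult, use U in \<open>auto simp: sum_distrib_left mult_ac\<close>)
  finally show "coeff (f * g * h) U = coeff (f * (g * h)) U" .
qed

instance grassmann :: (field) ring_1
proof
  fix f g h :: "'a grassmann"
  show "f * g * h = f * (g * h)" by (rule grassmann_mult_assoc)
  show "(f + g) * h = f * h + g * h"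
    by (rule grassmann_eqI) (simp add: coeff_mult algebra_simps sum.distrib)
  show "f * (g + h) = f * g + f * h"
    by (rule grassmann_eqI) (simp add: coeff_mult algebra_simps sum.distrib)
  show "1 * f = f"
  proof (rule grassmann_eqI)
    fix U :: "nat set" assume U: "finite U"
    have "coeff (1 * f) U = (\<Sum>S\<in>Pow U. if S = {} then coeff f U else 0)"
      unfolding coeff_mult[OF U] by (intro sum.cong) (auto simp: coeff_one)
    then show "coeff (1 * f) U = coeff f U" using U by simp
  qed
  show "f * 1 = f"
  proof (rule grassmann_eqI)
    fix U :: "nat set" assume U: "finite U"
    have "coeff (f * 1) U = (\<Sum>S\<in>Pow U. if S = U then coeff f U else 0)"
      unfolding coeff_mult[OF U] by (intro sum.cong) (auto simp: coeff_one)
    then show "coeff (f * 1) U = coeff f U" using U by simp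
  qed
  show "(0 :: 'a grassmann) \<noteq> 1"
  proof
    assume "(0 :: 'a grassmann) = 1"
    then have "coeff (0 :: 'a grassmann) {} = coeff 1 {}" by simp
    then show False by (simp add: coeff_one)
  qed
qed

lemma grassmann_scale_minus_one: "grassmann_scale (-1) f = - f"
  by (rule grassmann_eqI) simp

lemma grassmann_scale_mult_left: "grassmann_scale c f * g = grassmann_scale c (f * g)"
  by (rule grassmann_eqI) (simp add: coeff_mult sum_distrib_left mult_ac)

lemma grassmann_scale_mult_right: "f * grassmann_scale c g = grassmann_scale c (f * g)"
  by (rule grassmann_eqI) (simp add: coeff_mult sum_distrib_left mult_ac)

global_interpretation grassmann: vector_space grassmann_scale
  by standard (rule grassmann_eqI; simp add: algebra_simps)+

lemma coeff_sum: "coeff (\<Sum>i\<in>A. f i) S = (\<Sum>i\<in>A. coeff (f i) S)"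
  by (induction A rule: infinite_finite_induct) simp_all

lemma grassmann_expansion:
  "f = (\<Sum>S | coeff f S \<noteq> 0. grassmann_scale (coeff f S) (grassmann_basis S))"
proof (rule grassmann_eqI)
  fix T :: "nat set" assume T: "finite T"
  have "coeff (\<Sum>S | coeff f S \<noteq> 0. grassmann_scale (coeff f S) (grassmann_basis S)) T =
      (\<Sum>S | coeff f S \<noteq> 0. if S = T then coeff f T else 0)"
    unfolding coeff_sum by (intro sum.cong) (auto simp: coeff_basis T)
  also have "\<dots> = coeff f T"
    using finite_supp[of f] by simp
  finally show "coeff f T =
      coeff (\<Sum>S | coeff f S \<noteq> 0. grassmann_scale (coeff f S) (grassmann_basis S)) T" ..
qed

lemma grassmann_sign_square: "grassmann_sign S T * grassmann_sign S T = (1 :: 'k::field)"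
  by (simp add: grassmann_sign_def flip: power_mult_distrib)

lemma grassmann_basis_mult:
  assumes "finite S" "finite T" "S \<inter> T = {}"
  shows "grassmann_basis S * grassmann_basis T =
    (grassmann_scale (grassmann_sign S T) (grassmann_basis (S \<union> T)) :: 'k::field grassmann)"
proof (rule grassmann_eqI)
  fix U :: "nat set" assume U: "finite U"
  have "coeff (grassmann_basis S * grassmann_basis T :: 'k grassmann) U =
      (\<Sum>A\<in>Pow U. if A = S then (if U = S \<union> T then grassmann_sign S T else 0) else 0)"
    unfolding coeff_mult[OF U] using assms
    by (intro sum.cong) (auto simp: coeff_basis Un_absorb1 Diff_triv Un_Diff)
  then show "coeff (grassmann_basis S * grassmann_basis T :: 'k grassmann) U =
      coeff (grassmann_scale (grassmann_sign S T) (grassmann_basis (S \<union> T))) U"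
    using assms U by (auto simp: coeff_basis)
qed

lemma grassmann_basis_mult_eq_0:
  assumes "S \<inter> T \<noteq> {}"
  shows "grassmann_basis S * grassmann_basis T = (0 :: 'k::field grassmann)"
  using assms by (intro grassmann_eqI) (auto simp: coeff_mult coeff_basis intro!: sum.neutral split: if_splits)

lemma gen_square: "gen i * gen i = (0 :: 'k::field grassmann)"
  by (simp add: gen_def grassmann_basis_mult_eq_0)

lemma gen_anticommute: "gen i * gen j = - (gen j * gen i :: 'k::field grassmann)"
proof (cases "i = j")
  case False
  have "{(s, t). s \<in> {a} \<and> t \<in> {b} \<and> t < s} = (if b < a then {(a, b)} else {})" for a b :: nat
    by auto
  then have "grassmann_sign {i} {j} = (- grassmann_sign {j} {i} :: 'k)"
    using False by (simp add: grassmann_sign_def)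
  then show ?thesis
    using False
    by (simp add: gen_def grassmann_basis_mult insert_commute)
qed (simp add: gen_square)


section \<open>Parity and operators\<close>

text \<open>The component of parity \<open>p \<in> {0, 1}\<close> of an element.\<close>

definition parity_part :: "nat \<Rightarrow> 'k::field grassmann \<Rightarrow> 'k grassmann" where
  "parity_part p f = Abs_grassmann (\<lambda>S. if card S mod 2 = p then coeff f S else 0)"

lemma coeff_parity_part [simp]:
  "coeff (parity_part p f) S = (if card S mod 2 = p then coeff f S else 0)"
  unfolding parity_part_def
  by (subst coeff_Abs) (auto simp: coeff_infinite intro: finite_subset[OF _ finite_supp[of f]])

definition is_endo :: "('k::field grassmann \<Rightarrow> 'k grassmann) \<Rightarrow> bool" where
  "is_endo a \<longleftrightarrow> Vector_Spaces.linear grassmann_scale grassmann_scale a"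

lemma is_endo_iff:
  "is_endo a \<longleftrightarrow> (\<forall>f g. a (f + g) = a f + a g) \<and> (\<forall>c f. a (grassmann_scale c f) = grassmann_scale c (a f))"
  unfolding is_endo_def Vector_Spaces.linear_def module_hom_axioms_def module_hom_def
  using grassmann.vector_space_axioms grassmann.module_axioms by auto

text \<open>Sums of operators are the pointwise ones; products are compositions.\<close>

definition op_scale :: "'k::field \<Rightarrow> ('k grassmann \<Rightarrow> 'k grassmann) \<Rightarrow> ('k grassmann \<Rightarrow> 'k grassmann)" where
  "op_scale c a = (\<lambda>f. grassmann_scale c (a f))"

global_interpretation op: vector_space op_scale
  by standard (auto simp: op_scale_def fun_eq_iff grassmann.scale_right_distrib grassmann.scale_left_distrib)

text \<open>The component of parity \<open>p \<in> {0, 1}\<close> of an operator in \<open>End \<Lambda> = End\<^sub>0 \<Lambda> \<oplus> End\<^sub>1 \<Lambda>\<close>.\<close>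

definition op_part :: "nat \<Rightarrow> ('k::field grassmann \<Rightarrow> 'k grassmann) \<Rightarrow> ('k grassmann \<Rightarrow> 'k grassmann)" where
  "op_part p a = (\<lambda>f. \<Sum>r<2. parity_part ((p + r) mod 2) (a (parity_part r f)))"

definition odd_op :: "('k::field grassmann \<Rightarrow> 'k grassmann) \<Rightarrow> bool" where
  "odd_op a \<longleftrightarrow> op_part 1 a = a"

text \<open>The bilinear extension of \<open>[a, b] = a b - (-1)\<^bsup>deg a deg b\<^esup> b a\<close> for homogeneous \<open>a\<close>, \<open>b\<close>.\<close>

definition super_bracket ::
    "('k::field grassmann \<Rightarrow> 'k grassmann) \<Rightarrow> ('k grassmann \<Rightarrow> 'k grassmann) \<Rightarrow> ('k grassmann \<Rightarrow> 'k grassmann)" where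
  "super_bracket a b = (\<Sum>p<2. \<Sum>q<2.
     (op_part p a \<circ> op_part q b) - op_scale ((-1) ^ (p * q)) (op_part q b \<circ> op_part p a))"

lemma parity_part_add: "parity_part p (f + g) = parity_part p f + parity_part p g"
  by (rule grassmann_eqI) simp

lemma parity_part_scale: "parity_part p (grassmann_scale c f) = grassmann_scale c (parity_part p f)"
  by (rule grassmann_eqI) simp

lemma parity_part_0 [simp]: "parity_part p 0 = 0"
  by (rule grassmann_eqI) simp

lemma parity_part_parity_part:
  "parity_part p (parity_part q f) = (if p = q then parity_part p f else 0)"
  by (rule grassmann_eqI) simp

lemma parity_part_sum: "parity_part 0 f + parity_part 1 f = f"
  by (rule grassmann_eqI) auto

lemma lessThan_2: "{..<2} = {0, 1 :: nat}"
  by auto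

lemma is_endo_0: "is_endo a \<Longrightarrow> a 0 = 0"
  by (metis add_cancel_right_right is_endo_iff)

lemma is_endo_op_part: "is_endo a \<Longrightarrow> is_endo (op_part p a)"
  by (simp add: is_endo_iff op_part_def lessThan_2 parity_part_add parity_part_scale
      grassmann.scale_right_distrib)

lemma is_endo_comp: "is_endo a \<Longrightarrow> is_endo b \<Longrightarrow> is_endo (a \<circ> b)"
  by (simp add: is_endo_iff)

lemma subspace_is_endo: "op.subspace {a. is_endo a}"
  by (rule op.subspaceI)
     (auto simp: is_endo_iff op_scale_def grassmann.scale_right_distrib algebra_simps)

lemma is_endo_super_bracket: "is_endo a \<Longrightarrow> is_endo b \<Longrightarrow> is_endo (super_bracket a b)"
proof -
  assume ab: "is_endo a" "is_endo b"
  have "(op_part p a \<circ> op_part q b) - op_scale ((-1) ^ (p * q)) (op_part q b \<circ> op_part p a)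
      \<in> {a. is_endo a}" for p q
    by (rule op.subspace_diff[OF subspace_is_endo _ op.subspace_scale[OF subspace_is_endo]])
       (simp_all add: is_endo_comp is_endo_op_part ab)
  then have "super_bracket a b \<in> {a. is_endo a}"
    unfolding super_bracket_def
    by (intro op.subspace_sum[OF subspace_is_endo])
  then show ?thesis by simp
qed

lemma op_part_decomp:
  assumes "is_endo a"
  shows "a = op_part 0 a + op_part 1 a"
proof
  fix f
  have "a f = a (parity_part 0 f) + a (parity_part 1 f)"
    using assms unfolding is_endo_iff by (metis parity_part_sum)
  also have "\<dots> = (op_part 0 a + op_part 1 a) f"
  proof -
    have "(op_part 0 a + op_part 1 a) f =
        (parity_part 0 (a (parity_part 0 f)) + parity_part 1 (a (parity_part 0 f))) +
        (parity_part 0 (a (parity_part 1 f)) + parity_part 1 (a (parity_part 1 f)))"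
      by (simp add: op_part_def lessThan_2 add_ac)
    then show ?thesis by (simp only: parity_part_sum)
  qed
  finally show "a f = (op_part 0 a + op_part 1 a) f" .
qed

lemma op_part_op_part:
  assumes "is_endo a" "p < 2" "q < 2"
  shows "op_part p (op_part q a) = (if p = q then op_part p a else 0)"
proof -
  have "p = 0 \<or> p = 1" "q = 0 \<or> q = 1" using assms by auto
  then show ?thesis
    by (auto simp: op_part_def lessThan_2 fun_eq_iff parity_part_add parity_part_parity_part
        is_endo_0[OF assms(1)])
qed

lemma super_bracket_homogeneous:
  assumes "is_endo a" "is_endo b" "p < 2" "q < 2" "op_part p a = a" "op_part q b = b"
  shows "super_bracket a b = (a \<circ> b) - op_scale ((-1) ^ (p * q)) (b \<circ> a)"
proof -
  have "r < 2 \<Longrightarrow> op_part r a = (if r = p then a else 0)" for r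
    using op_part_op_part[of a r p] assms by auto
  moreover have "r < 2 \<Longrightarrow> op_part r b = (if r = q then b else 0)" for r
    using op_part_op_part[of b r q] assms by auto
  moreover have "p = 0 \<or> p = 1" "q = 0 \<or> q = 1" using assms by auto
  moreover have "a 0 = 0" "b 0 = 0"
    by (simp_all add: is_endo_0 assms)
  ultimately show ?thesis
    by (auto simp: super_bracket_def lessThan_2 fun_eq_iff op_scale_def)
qed


section \<open>Superderivations and the pivot elements\<close>

definition superderivation :: "nat \<Rightarrow> ('k::field grassmann \<Rightarrow> 'k grassmann) \<Rightarrow> bool" where
  "superderivation p D \<longleftrightarrow> is_endo D \<and> op_part p D = D \<and>
     (\<forall>q f g. parity_part q f = f \<longrightarrow> D (f * g) = D f * g + (-1) ^ (p * q) * (f * D g))"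

text \<open>
  \<open>\<partial>\<^sub>i\<close> sends \<open>x\<^sub>i e\<^sub>S\<close> to \<open>e\<^sub>S\<close> and \<open>e\<^sub>S\<close> to \<open>0\<close> for \<open>i \<notin> S\<close>.  It is characterised below as the only odd
  superderivation with \<open>\<partial>\<^sub>i x\<^sub>j = \<delta>\<^sub>i\<^sub>j\<close>.
\<close>

definition partial :: "nat \<Rightarrow> 'k::field grassmann \<Rightarrow> 'k grassmann" where
  "partial i f = Abs_grassmann
     (\<lambda>S. if i \<in> S then 0 else grassmann_sign {i} S * coeff f (insert i S))"

lemma coeff_partial [simp]:
  "coeff (partial i f) S = (if i \<in> S then 0 else grassmann_sign {i} S * coeff f (insert i S))"
proof -
  have "{S. (if i \<in> S then 0 else grassmann_sign {i} S * coeff f (insert i S)) \<noteq> 0} \<subseteq>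
      (\<lambda>S. S - {i}) ` {S. coeff f S \<noteq> 0}"
  proof
    fix S assume "S \<in> {S. (if i \<in> S then 0 else grassmann_sign {i} S * coeff f (insert i S)) \<noteq> 0}"
    then have "i \<notin> S" "coeff f (insert i S) \<noteq> 0" by (auto split: if_splits)
    then show "S \<in> (\<lambda>S. S - {i}) ` {S. coeff f S \<noteq> 0}"
      by (intro image_eqI[of _ _ "insert i S"]) auto
  qed
  then have "finite {S. (if i \<in> S then 0 else grassmann_sign {i} S * coeff f (insert i S)) \<noteq> 0}"
    by (rule finite_subset) (intro finite_imageI finite_supp)
  then show ?thesis
    unfolding partial_def by (subst coeff_Abs) (auto simp: coeff_infinite)
qed

lemma is_endo_partial: "is_endo (partial i :: 'k::field grassmann \<Rightarrow> 'k grassmann)"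
  unfolding is_endo_iff by (intro conjI allI; rule grassmann_eqI) (simp_all add: algebra_simps)

lemma partial_odd: "odd_op (partial i :: 'k::field grassmann \<Rightarrow> 'k grassmann)"
  unfolding odd_op_def op_part_def lessThan_2
proof (intro ext grassmann_eqI)
  fix f :: "'k grassmann" and S :: "nat set" assume "finite S"
  then show "coeff (\<Sum>r\<in>{0, 1}. parity_part ((1 + r) mod 2) (partial i (parity_part r f))) S =
      coeff (partial i f) S"
    by (cases "even (card S)") (auto simp: odd_iff_mod_2_eq_one mod_Suc)
qed

lemma grassmann_sign_swap:
  assumes "finite A" "i \<notin> A"
  shows "grassmann_sign A {i} * grassmann_sign {i} A = ((-1) ^ card A :: 'k::field)"
proof -
  have 1: "{(s, t). s \<in> A \<and> t \<in> {i} \<and> t < s} = (\<lambda>s. (s, i)) ` {s \<in> A. i < s}"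
    and 2: "{(s, t). s \<in> {i} \<and> t \<in> A \<and> t < s} = (\<lambda>t. (i, t)) ` {t \<in> A. t < i}"
    by auto
  have 3: "A = {s \<in> A. i < s} \<union> {t \<in> A. t < i}"
    using assms by (auto simp: not_less_iff_gr_or_eq)
  have "card A = card {s \<in> A. i < s} + card {t \<in> A. t < i}"
    by (subst 3, rule card_Un_disjoint) (use assms in auto)
  then show ?thesis
    unfolding grassmann_sign_def 1 2
    by (simp add: card_image inj_on_def power_add)
qed

lemma sum_Pow_insert:
  assumes "finite S" "i \<notin> S"
  shows "(\<Sum>A\<in>Pow (insert i S). F A) = (\<Sum>A\<in>Pow S. F (insert i A) + (F A :: 'k::field))"
proof -
  have "inj_on (insert i) (Pow S)" using assms by (auto simp: inj_on_def)
  moreover have "Pow S \<inter> insert i ` Pow S = {}" using assms by auto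
  ultimately show ?thesis
    using assms
    by (simp add: Pow_insert sum.union_disjoint sum.reindex sum.distrib add.commute)
qed

lemma partial_leibniz:
  fixes f g :: "'k::field grassmann"
  assumes f: "parity_part q f = f"
  shows "partial i (f * g) = partial i f * g + (-1) ^ q * (f * partial i g)"
proof (rule grassmann_eqI)
  fix S :: "nat set" assume S: "finite S"
  have par: "coeff f A = 0" if "card A mod 2 \<noteq> q" for A
    using that f by (metis coeff_parity_part)
  have parf: "(-1) ^ card A * coeff f A = (-1) ^ q * coeff f A" for A
  proof (cases "card A mod 2 = q")
    case True
    then have "even (card A) \<longleftrightarrow> even q" by auto
    then show ?thesis by (simp add: minus_one_power_iff)
  qed (simp add: par)
  have pm: "coeff ((-1) ^ n * h) T = (-1) ^ n * coeff h T" for n T and h :: "'k grassmann"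
    by (induction n arbitrary: h) (simp_all add: mult.assoc)
  note fin = finite_subset[OF _ S]
  show "coeff (partial i (f * g)) S = coeff (partial i f * g + (-1) ^ q * (f * partial i g)) S"
  proof (cases "i \<in> S")
    case False
    have eq: "grassmann_sign {i} S *
        (grassmann_sign (insert i A) (insert i S - insert i A) * coeff f (insert i A) *
           coeff g (insert i S - insert i A) +
         grassmann_sign A (insert i S - A) * coeff f A * coeff g (insert i S - A)) =
        grassmann_sign A (S - A) * coeff (partial i f) A * coeff g (S - A) +
        (-1) ^ q * (grassmann_sign A (S - A) * coeff f A * coeff (partial i g) (S - A))"
      if "A \<in> Pow S" for A
    proof -
      have A: "A \<subseteq> S" "finite A" "i \<notin> A" "finite (S - A)" using that fin False S by auto
      let ?B = "S - A"
      have sets: "insert i S - insert i A = ?B" "insert i S - A = insert i ?B" "S = A \<union> ?B"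
        using A False by auto
      have s1: "grassmann_sign {i} S = (grassmann_sign {i} A * grassmann_sign {i} ?B :: 'k)"
        using grassmann_sign_Un_right[of "{i}" A ?B] A sets(3) by auto
      have s2: "grassmann_sign (insert i A) ?B = (grassmann_sign {i} ?B * grassmann_sign A ?B :: 'k)"
        using grassmann_sign_Un_left[of "{i}" A ?B] A by auto
      have s3: "grassmann_sign A (insert i ?B) = (grassmann_sign A {i} * grassmann_sign A ?B :: 'k)"
        using grassmann_sign_Un_right[of A "{i}" ?B] A False by auto
      have s4: "grassmann_sign {i} ?B * grassmann_sign {i} ?B = (1 :: 'k)"
        by (rule grassmann_sign_square)
      have s5: "grassmann_sign A {i} * grassmann_sign {i} A = ((-1) ^ card A :: 'k)"
        using A by (intro grassmann_sign_swap)
      have e1: "grassmann_sign {i} S * (grassmann_sign (insert i A) ?B * coeff f (insert i A) * coeff g ?B) =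
          (grassmann_sign {i} ?B * grassmann_sign {i} ?B) *
          (grassmann_sign A ?B * (grassmann_sign {i} A * coeff f (insert i A)) * coeff g ?B)"
        by (simp only: s1 s2 mult_ac)
      have e2: "grassmann_sign {i} S *
            (grassmann_sign A (insert i ?B) * coeff f A * coeff g (insert i ?B)) =
          ((grassmann_sign A {i} * grassmann_sign {i} A) * coeff f A) *
          (grassmann_sign A ?B * (grassmann_sign {i} ?B * coeff g (insert i ?B)))"
        by (simp only: s1 s3 mult_ac)
      show ?thesis
        unfolding sets(1,2) distrib_left e1 e2 s4 s5 parf
        using A False by (simp add: mult_ac)
    qed
    have "coeff (partial i (f * g)) S = (\<Sum>A\<in>Pow S. grassmann_sign {i} S *
        (grassmann_sign (insert i A) (insert i S - insert i A) * coeff f (insert i A) *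
           coeff g (insert i S - insert i A) +
         grassmann_sign A (insert i S - A) * coeff f A * coeff g (insert i S - A)))"
      using False S
      by (simp only: coeff_partial if_False coeff_mult finite_insert sum_Pow_insert[OF S False])
         (simp only: sum_distrib_left)
    also have "\<dots> = (\<Sum>A\<in>Pow S. grassmann_sign A (S - A) * coeff (partial i f) A * coeff g (S - A) +
        (-1) ^ q * (grassmann_sign A (S - A) * coeff f A * coeff (partial i g) (S - A)))"
      by (intro sum.cong refl eq)
    also have "\<dots> = coeff (partial i f * g + (-1) ^ q * (f * partial i g)) S"
      unfolding coeff_add pm
      unfolding coeff_mult[OF S] sum_distrib_left sum.distrib[symmetric] ..
    finally show ?thesis .
  next
    case True
    define T where "T = S - {i}"
    have T: "S = insert i T" "finite T" "i \<notin> T" using S True by (auto simp: T_def)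
    have eq: "grassmann_sign A (insert i T - A) * coeff (partial i f) A * coeff g (insert i T - A) +
        (-1) ^ q * (grassmann_sign (insert i A) (insert i T - insert i A) * coeff f (insert i A) *
          coeff (partial i g) (insert i T - insert i A)) = 0"
      if "A \<in> Pow T" for A
    proof -
      have A: "A \<subseteq> T" "finite A" "i \<notin> A" "finite (T - A)" using that T finite_subset by auto
      let ?B = "T - A"
      have sets: "insert i T - insert i A = ?B" "insert i T - A = insert i ?B"
        using A T by auto
      have s2: "grassmann_sign (insert i A) ?B = (grassmann_sign {i} ?B * grassmann_sign A ?B :: 'k)"
        using grassmann_sign_Un_left[of "{i}" A ?B] A by auto
      have s3: "grassmann_sign A (insert i ?B) = (grassmann_sign A {i} * grassmann_sign A ?B :: 'k)"
        using grassmann_sign_Un_right[of A "{i}" ?B] A T by auto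
      have s4: "grassmann_sign {i} ?B * grassmann_sign {i} ?B = (1 :: 'k)"
        by (rule grassmann_sign_square)
      have s5: "grassmann_sign A {i} * grassmann_sign {i} A = ((-1) ^ card A :: 'k)"
        using A by (intro grassmann_sign_swap)
      have e1: "grassmann_sign A (insert i ?B) * (grassmann_sign {i} A * coeff f (insert i A)) * coeff g (insert i ?B) =
          ((grassmann_sign A {i} * grassmann_sign {i} A) * coeff f (insert i A)) *
          (grassmann_sign A ?B * coeff g (insert i ?B))"
        by (simp only: s3 mult_ac)
      have e2: "(-1) ^ card A * coeff f (insert i A) = - ((-1) ^ q * coeff f (insert i A))"
        using parf[of "insert i A"] A by (simp add: minus_equation_iff)
      have e3: "grassmann_sign (insert i A) ?B * coeff f (insert i A) *
            (grassmann_sign {i} ?B * coeff g (insert i ?B)) =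
          (grassmann_sign {i} ?B * grassmann_sign {i} ?B) *
          (grassmann_sign A ?B * coeff f (insert i A) * coeff g (insert i ?B))"
        by (simp only: s2 mult_ac)
      have p: "coeff (partial i f) A = grassmann_sign {i} A * coeff f (insert i A)"
        "coeff (partial i g) ?B = grassmann_sign {i} ?B * coeff g (insert i ?B)"
        using A T by simp_all
      show ?thesis
        unfolding sets(1,2) p e1 e3 s4 s5 e2 by (simp add: mult_ac)
    qed
    have "coeff (partial i f * g + (-1) ^ q * (f * partial i g)) S =
        (\<Sum>A\<in>Pow T. grassmann_sign A (insert i T - A) * coeff (partial i f) A * coeff g (insert i T - A) +
        (-1) ^ q * (grassmann_sign (insert i A) (insert i T - insert i A) * coeff f (insert i A) *
          coeff (partial i g) (insert i T - insert i A)))"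
      unfolding coeff_add pm
      unfolding coeff_mult[OF S] sum_distrib_left sum.distrib[symmetric]
      unfolding T(1) sum_Pow_insert[OF T(2,3)]
      by (intro sum.cong refl) (use T in auto)
    also have "\<dots> = 0"
      by (intro sum.neutral ballI eq)
    finally show ?thesis using True by simp
  qed
qed

lemma superderivation_partial: "superderivation 1 (partial i :: 'k::field grassmann \<Rightarrow> 'k grassmann)"
  using is_endo_partial partial_odd partial_leibniz
  unfolding superderivation_def odd_op_def mult_1 by blast

lemma partial_gen: "partial i (gen j) = (if i = j then 1 else (0 :: 'k::field grassmann))"
  by (rule grassmann_eqI) (auto simp: gen_def coeff_basis coeff_one)

lemma superderivation_ext:
  fixes D E :: "'k::field grassmann \<Rightarrow> 'k grassmann"
  assumes D: "superderivation p D" and E: "superderivation p E" and eq: "\<And>j. D (gen j) = E (gen j)"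
  shows "D = E"
proof -
  have par1: "parity_part 0 1 = (1 :: 'k grassmann)"
    by (rule grassmann_eqI) (simp add: coeff_one)
  have pargen: "parity_part 1 (gen j) = (gen j :: 'k grassmann)" for j
    by (rule grassmann_eqI) (simp add: gen_def coeff_basis)
  have one: "F 1 = 0" if "superderivation p F" for F :: "'k grassmann \<Rightarrow> 'k grassmann"
  proof -
    have "F (1 * 1) = F 1 * 1 + (-1) ^ (p * 0) * (1 * F 1)"
      using that par1 unfolding superderivation_def by blast
    then show ?thesis by simp
  qed
  have endo: "is_endo D" "is_endo E" using D E by (auto simp: superderivation_def)
  have basis: "D (grassmann_basis S) = E (grassmann_basis S)" if "finite S" for S
    using that
  proof (induction S)
    case empty
    then show ?case using one[OF D] one[OF E] by (simp flip: one_grassmann_def)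
  next
    case (insert i S)
    let ?s = "grassmann_sign {i} S :: 'k"
    have *: "grassmann_basis (insert i S) = grassmann_scale ?s (gen i * grassmann_basis S)"
      using insert.hyps
      by (simp add: gen_def grassmann_basis_mult grassmann_sign_square)
    have "D (gen i * grassmann_basis S) = E (gen i * grassmann_basis S)"
      using D E pargen[of i] insert.IH eq[of i] unfolding superderivation_def by simp
    then show ?case using endo unfolding * is_endo_iff by simp
  qed
  have lin: "F f = (\<Sum>S | coeff f S \<noteq> 0. grassmann_scale (coeff f S) (F (grassmann_basis S)))"
    if "is_endo F" for F :: "'k grassmann \<Rightarrow> 'k grassmann" and f
  proof -
    interpret Vector_Spaces.linear grassmann_scale grassmann_scale F
      using that by (simp add: is_endo_def)
    show ?thesis by (subst grassmann_expansion[of f]) (simp add: sum scale)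
  qed
  show ?thesis
  proof
    fix f
    show "D f = E f"
      unfolding lin[OF endo(1), of f] lin[OF endo(2), of f]
      by (intro sum.cong refl) (metis (mono_tags) basis coeff_infinite mem_Collect_eq)
  qed
qed

theorem partial_characterisation:
  fixes D :: "'k::field grassmann \<Rightarrow> 'k grassmann"
  shows "superderivation 1 D \<and> (\<forall>j. D (gen j) = (if i = j then 1 else 0)) \<longleftrightarrow> D = partial i"
proof
  assume "superderivation 1 D \<and> (\<forall>j. D (gen j) = (if i = j then 1 else 0))"
  then show "D = partial i"
    by (intro superderivation_ext[of 1 D "partial i"] superderivation_partial) (auto simp: partial_gen)
next
  assume "D = partial i"
  then show "superderivation 1 D \<and> (\<forall>j. D (gen j) = (if i = j then 1 else 0))"
    by (simp only: superderivation_partial partial_gen simp_thms)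
qed

lemma partial_eventually_0: "\<exists>N. \<forall>n\<ge>N. partial n f = 0"
proof -
  have "finite (\<Union>{S. coeff f S \<noteq> 0})"
    using finite_supp[of f] coeff_infinite[of _ f] by auto
  then obtain N where N: "\<forall>n\<in>\<Union>{S. coeff f S \<noteq> 0}. n < N"
    using finite_nat_set_iff_bounded by blast
  have "partial n f = 0" if "n \<ge> N" for n
  proof (rule grassmann_eqI)
    fix S
    have "coeff f (insert n S) = 0" using N that by force
    then show "coeff (partial n f) S = coeff 0 S" by simp
  qed
  then show ?thesis by blast
qed

text \<open>
  Unfolding the recursion gives
  \<open>v\<^sub>i f = \<Sum>\<^sub>k x\<^sub>i x\<^bsub>i+1\<^esub> \<cdots> x\<^bsub>i+2k-1\<^esub> \<partial>\<^bsub>i+2k\<^esub> f\<close>,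
  where only finitely many terms are non-zero; \<open>pivot_rec\<close> below recovers the recursion.
\<close>

definition pivot :: "nat \<Rightarrow> 'k::field grassmann \<Rightarrow> 'k grassmann" where
  "pivot i f = (\<Sum>k | partial (i + 2 * k) f \<noteq> 0. prod_list (map gen [i..<i + 2 * k]) * partial (i + 2 * k) f)"

lemma pivot_eq:
  assumes "\<And>k. k \<ge> N \<Longrightarrow> partial (i + 2 * k) f = 0"
  shows "pivot i f = (\<Sum>k<N. prod_list (map gen [i..<i + 2 * k]) * partial (i + 2 * k) f)"
  unfolding pivot_def
  by (rule sum.mono_neutral_left) (use assms not_less in auto)

theorem pivot_rec: "pivot i f = partial i f + gen i * gen (i + 1) * pivot (i + 2) f"
proof -
  obtain N where N: "\<And>n. n \<ge> N \<Longrightarrow> partial n f = 0"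
    using partial_eventually_0 by blast
  have 1: "pivot i f = (\<Sum>k<Suc N. prod_list (map gen [i..<i + 2 * k]) * partial (i + 2 * k) f)"
    by (rule pivot_eq) (simp add: N)
  have 2: "pivot (i + 2) f =
      (\<Sum>k<N. prod_list (map gen [i + 2..<i + 2 + 2 * k]) * partial (i + 2 + 2 * k) f)"
    by (rule pivot_eq) (simp add: N)
  have 3: "[i..<i + 2 * Suc k] = i # (i + 1) # [i + 2..<i + 2 + 2 * k]" for k
    by (simp add: upt_rec[of i] upt_rec[of "Suc i"])
  show ?thesis
    unfolding 1 2 sum.lessThan_Suc_shift 3
    by (simp add: sum_distrib_left mult.assoc)
qed

lemma is_endo_pivot: "is_endo (pivot i :: 'k::field grassmann \<Rightarrow> 'k grassmann)"
proof -
  have endo: "partial n (f + g) = partial n f + partial n g"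
    "partial n (grassmann_scale c f) = grassmann_scale c (partial n f)"
    for n c and f g :: "'k grassmann"
    using is_endo_partial[of n, where ?'k = 'k] unfolding is_endo_iff by blast+
  have "pivot i (f + g) = pivot i f + pivot i g" for f g :: "'k grassmann"
  proof -
    obtain N M where N: "\<And>n. n \<ge> N \<Longrightarrow> partial n f = 0" and M: "\<And>n. n \<ge> M \<Longrightarrow> partial n g = 0"
      using partial_eventually_0 by meson
    have "pivot i h = (\<Sum>k<N + M. prod_list (map gen [i..<i + 2 * k]) * partial (i + 2 * k) h)"
      if "h \<in> {f, g, f + g}" for h
      by (rule pivot_eq) (use that N M endo in auto)
    then show ?thesis by (simp add: endo distrib_left sum.distrib)
  qed
  moreover have "pivot i (grassmann_scale c f) = grassmann_scale c (pivot i f)" for c and f :: "'k grassmann"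
  proof -
    obtain N where N: "\<And>n. n \<ge> N \<Longrightarrow> partial n f = 0"
      using partial_eventually_0 by meson
    have "pivot i h = (\<Sum>k<N. prod_list (map gen [i..<i + 2 * k]) * partial (i + 2 * k) h)"
      if "h \<in> {f, grassmann_scale c f}" for h
      by (rule pivot_eq) (use that N endo in auto)
    then show ?thesis
      by (simp add: endo grassmann.scale_sum_right grassmann_scale_mult_right)
  qed
  ultimately show ?thesis by (simp add: is_endo_iff)
qed


section \<open>The Lie superalgebra generated by two pivot elements\<close>

definition lie_superalgebra :: "('k::field grassmann \<Rightarrow> 'k grassmann) set \<Rightarrow> bool" where
  "lie_superalgebra U \<longleftrightarrow>
     U \<subseteq> {a. is_endo a} \<and> op.subspace U \<and>
     (\<forall>a\<in>U. \<forall>p<2. op_part p a \<in> U) \<and>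
     (\<forall>a\<in>U. \<forall>b\<in>U. super_bracket a b \<in> U) \<and>
     (CHAR('k) = 2 \<longrightarrow> (\<forall>a\<in>U. odd_op a \<longrightarrow> a \<circ> a \<in> U))"

definition pivot_algebra :: "('k::field grassmann \<Rightarrow> 'k grassmann) set" where
  "pivot_algebra = \<Inter>{U. lie_superalgebra U \<and> pivot 0 \<in> U \<and> pivot 1 \<in> U}"

lemma lie_superalgebra_endos: "lie_superalgebra {a :: 'k::field grassmann \<Rightarrow> 'k grassmann. is_endo a}"
  unfolding lie_superalgebra_def
  by (auto intro: subspace_is_endo is_endo_op_part is_endo_super_bracket is_endo_comp)

theorem lie_superalgebra_pivot_algebra:
  "lie_superalgebra (pivot_algebra :: ('k::field grassmann \<Rightarrow> 'k grassmann) set)"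
  "pivot 0 \<in> (pivot_algebra :: ('k grassmann \<Rightarrow> 'k grassmann) set)"
  "pivot 1 \<in> (pivot_algebra :: ('k grassmann \<Rightarrow> 'k grassmann) set)"
proof -
  have "pivot_algebra \<subseteq> {a :: 'k grassmann \<Rightarrow> 'k grassmann. is_endo a}"
    unfolding pivot_algebra_def
    by (rule Inter_lower) (simp add: lie_superalgebra_endos is_endo_pivot)
  moreover have "op.subspace (pivot_algebra :: ('k grassmann \<Rightarrow> 'k grassmann) set)"
    unfolding pivot_algebra_def by (rule op.subspace_Inter) (simp add: lie_superalgebra_def)
  ultimately show "lie_superalgebra (pivot_algebra :: ('k grassmann \<Rightarrow> 'k grassmann) set)"
    unfolding lie_superalgebra_def
    by (intro conjI) (simp_all add: pivot_algebra_def lie_superalgebra_def)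
qed (simp_all add: pivot_algebra_def)

text \<open>
  \<open>lie_monomial n a\<close>: the operator \<open>a\<close> is the value of a Lie monomial with \<open>fst n\<close> factors \<open>v\<^sub>0\<close> and
  \<open>snd n\<close> factors \<open>v\<^sub>1\<close>.
\<close>

inductive lie_monomial :: "nat \<times> nat \<Rightarrow> ('k::field grassmann \<Rightarrow> 'k grassmann) \<Rightarrow> bool" where
  gen0: "lie_monomial (1, 0) (pivot 0)"
| gen1: "lie_monomial (0, 1) (pivot 1)"
| bracket: "lie_monomial m a \<Longrightarrow> lie_monomial n b \<Longrightarrow> lie_monomial (m + n) (super_bracket a b)"
| square: "CHAR('k) = 2 \<Longrightarrow> lie_monomial n (a :: 'k grassmann \<Rightarrow> 'k grassmann) \<Longrightarrow> odd_op a \<Longrightarrow>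
    lie_monomial (n + n) (a \<circ> a)"

definition pivot_component :: "nat \<times> nat \<Rightarrow> ('k::field grassmann \<Rightarrow> 'k grassmann) set" where
  "pivot_component n = op.span {a. lie_monomial n a}"

definition is_gradation ::
    "('k::field grassmann \<Rightarrow> 'k grassmann) set \<Rightarrow> (nat \<times> nat \<Rightarrow> ('k grassmann \<Rightarrow> 'k grassmann) set) \<Rightarrow> bool" where
  "is_gradation L C \<longleftrightarrow>
     (\<forall>n. op.subspace (C n) \<and> C n \<subseteq> L) \<and>
     (\<forall>a\<in>L. \<exists>!c. finite {n. c n \<noteq> 0} \<and> (\<forall>n. c n \<in> C n) \<and> a = (\<Sum>n | c n \<noteq> 0. c n)) \<and>
     (\<forall>m n. \<forall>a\<in>C m. \<forall>b\<in>C n. super_bracket a b \<in> C (m + n)) \<and>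
     (CHAR('k) = 2 \<longrightarrow> (\<forall>n. \<forall>a\<in>C n. odd_op a \<longrightarrow> a \<circ> a \<in> C (n + n)))"

end

theory Submission
  imports Defs "HOL-Library.Nat_Bijection"
begin

text \<open>
  Up to scalars, every Lie monomial is zero or a \<^emph>\<open>standard\<close> monomial \<open>e\<^sub>S v\<^sub>m\<close>, where \<open>S\<close> consists of
  indices below \<open>m\<close> and does not contain both \<open>m - 1\<close> and \<open>m - 2\<close>.  Standard monomials are closed under the
  bracket because \<open>v\<^sub>n\<^sup>2 = x\<^bsub>n+1\<^esub> v\<^bsub>n+2\<^esub>\<close>, and for \<open>n < m\<close> the bracket \<open>[v\<^sub>n, v\<^sub>m]\<close> is a multiple of
  \<open>x\<^sub>n \<cdots> x\<^bsub>m-1\<^esub> v\<^bsub>m+1\<^esub>\<close> or of \<open>x\<^sub>n \<cdots> x\<^bsub>m-1\<^esub> x\<^bsub>m+1\<^esub> v\<^bsub>m+2\<^esub>\<close>, depending on the parity of \<open>m - n\<close>.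

  Giving \<open>\<partial>\<^sub>i\<close> the weight \<open>(2\<^sup>i, (-1)\<^sup>i)\<close> and \<open>x\<^sub>i\<close> its negative makes each \<open>v\<^sub>i\<close> homogeneous, and an operator of
  multidegree \<open>(n\<^sub>1, n\<^sub>2)\<close> has weight \<open>(n\<^sub>1 + 2 n\<^sub>2, n\<^sub>1 - n\<^sub>2)\<close>.  Binary expansion shows that a standard monomial is
  determined by its weight, so every multidegree carries at most one of them.  The sum of the components is
  direct since standard monomials are linearly independent: \<open>e\<^sub>S v\<^sub>m\<close> sends \<open>x\<^sub>m\<close> to \<open>e\<^sub>S\<close> and kills \<open>x\<^sub>j\<close> for
  \<open>j < m\<close>.
\<close>

section \<open>Pivot elements as superderivations\<close>

lemma coeff_minus_one_power: "coeff ((-1) ^ n * f) S = (-1) ^ n * coeff f S"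
  by (cases "even n") simp_all

lemma grassmann_scale_minus_one_power: "grassmann_scale ((-1) ^ n) f = (-1) ^ n * f"
  by (rule grassmann_eqI) (simp add: coeff_minus_one_power)

lemma parity_part_eq_self_iff: "parity_part p f = f \<longleftrightarrow> (\<forall>S. coeff f S \<noteq> 0 \<longrightarrow> card S mod 2 = p)"
proof
  assume "parity_part p f = f"
  then show "\<forall>S. coeff f S \<noteq> 0 \<longrightarrow> card S mod 2 = p"
    by (metis coeff_parity_part)
next
  assume "\<forall>S. coeff f S \<noteq> 0 \<longrightarrow> card S mod 2 = p"
  then show "parity_part p f = f"
    by (intro grassmann_eqI) auto
qed

lemma parity_part_mult:
  fixes f g :: "'k::field grassmann"
  assumes "parity_part p f = f" "parity_part q g = g"
  shows "parity_part ((p + q) mod 2) (f * g) = f * g"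
  unfolding parity_part_eq_self_iff
proof (intro allI impI)
  fix U assume nz: "coeff (f * g) U \<noteq> 0"
  then have U: "finite U" using coeff_infinite by blast
  obtain S where S: "S \<subseteq> U" "grassmann_sign S (U - S) * coeff f S * coeff g (U - S) \<noteq> 0"
    using nz unfolding coeff_mult[OF U] by (metis (no_types, lifting) PowD sum.neutral)
  then have "p = card S mod 2" "q = card (U - S) mod 2"
    using assms unfolding parity_part_eq_self_iff by auto
  moreover have "card U = card S + card (U - S)"
    using S U by (metis card_Diff_subset card_mono finite_subset le_add_diff_inverse)
  ultimately show "card U mod 2 = (p + q) mod 2"
    by (simp only: mod_add_eq)
qed

lemma parity_part_basis: "parity_part (card S mod 2) (grassmann_basis S) = grassmann_basis S"
  by (simp add: parity_part_eq_self_iff coeff_basis)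

text \<open>Each pair in \<open>S \<times> T\<close> is an inversion in exactly one of the two
  orders, so the two inversion counts add up to \<open>card S * card T\<close>.\<close>

lemma grassmann_sign_commute:
  assumes "finite S" "finite T" "S \<inter> T = {}"
  shows "grassmann_sign T S = ((-1) ^ (card S * card T) * grassmann_sign S T :: 'k::field)"
proof -
  let ?A = "{(s, t). s \<in> S \<and> t \<in> T \<and> t < s}" and ?B = "{(t, s). t \<in> T \<and> s \<in> S \<and> s < t}"
  have un: "S \<times> T = ?A \<union> prod.swap ` ?B" using assms(3)
    by (auto simp: image_iff not_less_iff_gr_or_eq)
  have fin: "finite ?A" "finite ?B"
    by (rule finite_subset[of _ "S \<times> T"], use assms in auto)
       (rule finite_subset[of _ "T \<times> S"], use assms in auto)
  have "card (S \<times> T) = card ?A + card (prod.swap ` ?B)"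
    unfolding un by (rule card_Un_disjoint) (use fin in auto)
  also have "card (prod.swap ` ?B) = card ?B"
    by (rule card_image) (auto simp: inj_on_def)
  finally have "card S * card T = card ?A + card ?B"
    by (simp only: card_cartesian_product)
  then have "(-1) ^ (card S * card T) * grassmann_sign S T =
      (grassmann_sign S T * grassmann_sign S T * grassmann_sign T S :: 'k)"
    by (simp add: grassmann_sign_def power_add mult_ac)
  then show ?thesis by (simp add: grassmann_sign_square)
qed

lemma grassmann_supercommute:
  fixes f g :: "'k::field grassmann"
  assumes "parity_part p f = f" "parity_part q g = g"
  shows "g * f = (-1) ^ (p * q) * (f * g)"
proof (rule grassmann_eqI)
  fix U :: "nat set" assume U: "finite U"
  have "coeff (g * f) U = (\<Sum>S\<in>Pow U. grassmann_sign (U - S) S * coeff g (U - S) * coeff f S)"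
    unfolding coeff_mult[OF U]
    by (rule sum.reindex_bij_witness[of _ "\<lambda>S. U - S" "\<lambda>S. U - S"]) (auto simp: double_diff)
  also have "\<dots> = (\<Sum>S\<in>Pow U. (-1) ^ (p * q) * (grassmann_sign S (U - S) * coeff f S * coeff g (U - S)))"
  proof (intro sum.cong refl)
    fix S assume S: "S \<in> Pow U"
    show "grassmann_sign (U - S) S * coeff g (U - S) * coeff f S =
        (-1) ^ (p * q) * (grassmann_sign S (U - S) * coeff f S * coeff g (U - S))"
    proof (cases "coeff f S = 0 \<or> coeff g (U - S) = 0")
      case False
      then have "card S mod 2 = p" "card (U - S) mod 2 = q"
        using assms unfolding parity_part_eq_self_iff by auto
      then have "even (card S * card (U - S)) \<longleftrightarrow> even (p * q)" by auto
      then have "(-1) ^ (card S * card (U - S)) = ((-1) ^ (p * q) :: 'k)"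
        by (simp add: minus_one_power_iff)
      moreover have "finite S" "finite (U - S)" using S U finite_subset by auto
      ultimately show ?thesis
        using grassmann_sign_commute[of S "U - S", where 'k = 'k] by (simp add: mult_ac)
    qed auto
  qed
  finally show "coeff (g * f) U = coeff ((-1) ^ (p * q) * (f * g)) U"
    by (subst coeff_minus_one_power) (simp only: coeff_mult[OF U] sum_distrib_left)
qed

text \<open>Homogeneity of an operator may be tested on homogeneous arguments, because every element
  is the sum of its two parity parts. The converse is \<open>parity_part_apply\<close>.\<close>

lemma op_part_eq_selfI:
  assumes "is_endo a" "p < 2"
    "\<And>q f. q < 2 \<Longrightarrow> parity_part q f = f \<Longrightarrow> parity_part ((p + q) mod 2) (a f) = a f"
  shows "op_part p a = a"
proof
  fix f
  have "op_part p a f = a (parity_part 0 f) + a (parity_part 1 f)"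
    using assms(3)[of 0 "parity_part 0 f"] assms(3)[of 1 "parity_part 1 f"]
    by (simp add: op_part_def lessThan_2 parity_part_parity_part)
  also have "\<dots> = a f"
    using assms(1) unfolding is_endo_iff by (metis parity_part_sum)
  finally show "op_part p a f = a f" .
qed

lemma parity_part_apply:
  assumes a: "is_endo a" "op_part p a = a" and f: "parity_part q f = f" "q < 2"
  shows "parity_part ((p + q) mod 2) (a f) = a f"
proof -
  have 0: "parity_part r f = (if r = q then f else 0)" for r
    using f(1) parity_part_parity_part[of r q f] by (cases "r = q") simp_all
  have "a f = op_part p a f" using a(2) by simp
  also have "\<dots> = parity_part ((p + q) mod 2) (a f)"
    using f(2) by (auto simp: op_part_def lessThan_2 0 is_endo_0[OF a(1)] less_2_cases_iff)
  finally show ?thesis ..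
qed

section \<open>The series of a pivot element and its Leibniz rule\<close>

lemma prod_list_gen_upt:
  "i \<le> j \<Longrightarrow> prod_list (map gen [i..<j]) = (grassmann_basis {i..<j} :: 'k::field grassmann)"
proof (induction j rule: dec_induct)
  case base
  then show ?case by (simp add: one_grassmann_def)
next
  case (step j)
  have *: "{(s, t). s \<in> {i..<j} \<and> t \<in> {j} \<and> t < s} = {}" by auto
  have "grassmann_sign {i..<j} {j} = (1 :: 'k)" unfolding grassmann_sign_def * by simp
  moreover have "{i..<j} \<union> {j} = {i..<Suc j}" using step by auto
  ultimately show ?case
    using step grassmann_basis_mult[of "{i..<j}" "{j}", where 'k = 'k] by (simp add: gen_def)
qed

lemma pivot_eq_basis:
  assumes "\<And>n. n \<ge> N \<Longrightarrow> partial n f = 0"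
  shows "pivot i f = (\<Sum>k<N. grassmann_basis {i..<i + 2 * k} * partial (i + 2 * k) f)"
  by (subst pivot_eq[of N]) (simp_all add: assms prod_list_gen_upt)

text \<open>A common truncation bound, so that the series of a pivot element at several arguments
  can be compared term by term.\<close>

lemma partial_eventually_0_finite:
  "finite F \<Longrightarrow> \<exists>N. \<forall>n\<ge>N. \<forall>f\<in>F. partial n f = 0"
proof (induction F rule: finite_induct)
  case (insert g F)
  then obtain N where "\<forall>n\<ge>N. \<forall>f\<in>F. partial n f = 0" by blast
  moreover obtain M where "\<forall>n\<ge>M. partial n g = 0" using partial_eventually_0 by blast
  ultimately have "\<forall>n\<ge>N + M. \<forall>f\<in>insert g F. partial n f = 0" by auto
  then show ?case by blast
qed auto

lemma parity_part_partial:
  "parity_part q f = f \<Longrightarrow> q < 2 \<Longrightarrow> parity_part ((1 + q) mod 2) (partial i f) = partial i f"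
  using parity_part_apply[OF is_endo_partial] partial_odd[of i] unfolding odd_op_def by blast

lemma parity_part_block: "parity_part 0 (grassmann_basis {i..<i + 2 * k}) = grassmann_basis {i..<i + 2 * k}"
  using parity_part_basis[of "{i..<i + 2 * k}"] by simp

lemma parity_part_sum_eq: 
  "(\<And>k. k \<in> A \<Longrightarrow> parity_part p (F k) = F k) \<Longrightarrow> parity_part p (\<Sum>k\<in>A. F k) = (\<Sum>k\<in>A. F k)"
  by (induction A rule: infinite_finite_induct) (auto simp: parity_part_add)

lemma pivot_odd: "op_part 1 (pivot i :: 'k::field grassmann \<Rightarrow> 'k grassmann) = pivot i"
proof (rule op_part_eq_selfI[OF is_endo_pivot])
  fix q and f :: "'k grassmann" assume q: "q < 2" "parity_part q f = f"
  obtain N where N: "\<And>n. n \<ge> N \<Longrightarrow> partial n f = 0" using partial_eventually_0 by blast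
  show "parity_part ((1 + q) mod 2) (pivot i f) = pivot i f"
    unfolding pivot_eq_basis[of N f, OF N, simplified]
    using parity_part_mult[OF parity_part_block parity_part_partial] q
    by (intro parity_part_sum_eq) (simp add: mod_add_right_eq)
qed simp

text \<open>The Leibniz rule holds for each summand of the series: the block in front of the partial
  derivative has even length and therefore moves past \<open>f\<close> without a sign.\<close>

lemma superderivation_pivot: "superderivation 1 (pivot i :: 'k::field grassmann \<Rightarrow> 'k grassmann)"
  unfolding superderivation_def
proof (intro conjI allI impI is_endo_pivot pivot_odd)
  fix q and f g :: "'k grassmann" assume q: "parity_part q f = f"
  obtain N where N: "\<And>n h. n \<ge> N \<Longrightarrow> h \<in> {f, g, f * g} \<Longrightarrow> partial n h = 0"
    using partial_eventually_0_finite[of "{f, g, f * g}"] by blast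
  have piv: "pivot i h = (\<Sum>k<N. grassmann_basis {i..<i + 2 * k} * partial (i + 2 * k) h)"
    if "h \<in> {f, g, f * g}" for h
    by (rule pivot_eq_basis) (use that N in blast)
  have "grassmann_basis {i..<i + 2 * k} * partial (i + 2 * k) (f * g) =
      grassmann_basis {i..<i + 2 * k} * partial (i + 2 * k) f * g +
      (-1) ^ q * (f * (grassmann_basis {i..<i + 2 * k} * partial (i + 2 * k) g))" for k
    using grassmann_supercommute[OF parity_part_block q, of i k]
    by (cases "even q") (simp_all add: partial_leibniz[OF q] algebra_simps flip: mult.assoc)
  then show "pivot i (f * g) = pivot i f * g + (-1) ^ (1 * q) * (f * pivot i g)"
    by (simp add: piv sum.distrib sum_distrib_left sum_distrib_right)
qed

lemmas pivot_leibniz = superderivation_pivot[unfolded superderivation_def, THEN conjunct2, THEN conjunct2,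
    rule_format, simplified mult_1]

section \<open>Values of pivot elements on basis elements and generators\<close>

lemma pivot_add: "pivot i (f + g) = pivot i f + pivot i g"
  and pivot_scale: "pivot i (grassmann_scale c f) = grassmann_scale c (pivot i f)"
  using is_endo_pivot[of i] unfolding is_endo_iff by auto

lemma partial_basis:
  "partial i (grassmann_basis S) =
    (if finite S \<and> i \<in> S then grassmann_scale (grassmann_sign {i} (S - {i})) (grassmann_basis (S - {i})) else 0)"
  by (rule grassmann_eqI) (auto simp: coeff_basis split: if_splits)

text \<open>Each summand dies: either the letter to be removed is absent from \<open>S\<close>, or
  the block put in its place repeats a letter of \<open>S\<close>.\<close>

lemma pivot_basis_eq_0:
  assumes "\<And>k. i + 2 * k \<in> S \<Longrightarrow> S \<inter> {i..<i + 2 * k} \<noteq> {}"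
  shows "pivot i (grassmann_basis S) = (0 :: 'k::field grassmann)"
proof -
  obtain N where N: "\<And>n. n \<ge> N \<Longrightarrow> partial n (grassmann_basis S :: 'k grassmann) = 0" using partial_eventually_0 by blast
  have "grassmann_basis {i..<i + 2 * k} * partial (i + 2 * k) (grassmann_basis S) = (0 :: 'k grassmann)" for k
    using assms[of k] grassmann_basis_mult_eq_0[of "{i..<i + 2 * k}" "S - {i + 2 * k}"]
    by (force simp: partial_basis grassmann_scale_mult_right)
  then show ?thesis
    by (subst pivot_eq_basis[of N]) (simp_all add: N)
qed

text \<open>Only summand \<open>k\<close> survives. For \<open>l < k\<close> the letter
  \<open>i + 2 * l\<close> is absent from \<open>S\<close>; for \<open>l > k\<close> the block
  contains \<open>i + 2 * k\<close>, which is still present. The scalar is a product of two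
  signs.\<close>

lemma pivot_basis:
  assumes "finite S" "i + 2 * k \<in> S" "S \<inter> {i..<i + 2 * k} = {}"
  shows "\<exists>c. pivot i (grassmann_basis S) =
    grassmann_scale (c :: 'k::field) (grassmann_basis ({i..<i + 2 * k} \<union> (S - {i + 2 * k})))"
proof -
  let ?F = "\<lambda>k. grassmann_basis {i..<i + 2 * k} * partial (i + 2 * k) (grassmann_basis S) :: 'k grassmann"
  obtain N where N: "\<And>n. n \<ge> N \<Longrightarrow> partial n (grassmann_basis S :: 'k grassmann) = 0" using partial_eventually_0 by blast
  have "?F l = 0" if "l \<noteq> k" for l
  proof (cases "l < k")
    case True
    then have "i + 2 * l \<notin> S" using assms(3) by force
    then show ?thesis by (simp add: partial_basis)
  next
    case False
    then have "i + 2 * k \<in> {i..<i + 2 * l} \<inter> (S - {i + 2 * l})" using assms(2) that by auto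
    then have "{i..<i + 2 * l} \<inter> (S - {i + 2 * l}) \<noteq> {}" by blast
    then show ?thesis
      by (simp add: partial_basis grassmann_scale_mult_right grassmann_basis_mult_eq_0)
  qed
  then have "(\<Sum>l<N + Suc k. ?F l) = (\<Sum>l\<in>{k}. ?F l)"
    by (intro sum.mono_neutral_right) auto
  then have "pivot i (grassmann_basis S) = ?F k"
    by (subst pivot_eq_basis[of "N + Suc k"]) (simp_all add: N)
  also have "\<dots> = grassmann_scale (grassmann_sign {i + 2 * k} (S - {i + 2 * k}) *
      grassmann_sign {i..<i + 2 * k} (S - {i + 2 * k}))
      (grassmann_basis ({i..<i + 2 * k} \<union> (S - {i + 2 * k})))"
  proof -
    have "{i..<i + 2 * k} \<inter> (S - {i + 2 * k}) = {}" using assms(3) by blast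
    then show ?thesis
      using assms by (simp add: partial_basis grassmann_scale_mult_right grassmann_basis_mult)
  qed
  finally show ?thesis by blast
qed

text \<open>With \<open>pivot_gen_less\<close> this gives the triangular evaluation behind linear
  independence.\<close>

lemma pivot_gen_same: "pivot m (gen m) = 1"
proof -
  have "partial (m + 2 + 2 * k) (gen m) = (0 :: 'a grassmann)" for k by (simp add: partial_gen)
  then have "pivot (m + 2) (gen m) = (0 :: 'a grassmann)"
    by (subst pivot_eq[of 0]) simp_all
  then show ?thesis by (subst pivot_rec) (simp add: partial_gen)
qed

lemma pivot_gen_less: "j < m \<Longrightarrow> pivot m (gen j) = 0"
  by (subst pivot_eq[of 0]) (auto simp: partial_gen)


section \<open>The super bracket\<close>

lemma op_part_add: "op_part p (a + b) = op_part p a + op_part p b"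
  by (simp add: op_part_def fun_eq_iff parity_part_add sum.distrib)

lemma op_part_scale: "op_part p (op_scale c a) = op_scale c (op_part p a)"
  by (simp add: op_part_def fun_eq_iff op_scale_def parity_part_scale grassmann.scale_sum_right)

lemma super_bracket_add_left:
  assumes "is_endo a" "is_endo b" "is_endo c"
  shows "super_bracket (a + b) c = super_bracket a c + super_bracket b c"
proof -
  have "op_part q c (f + g) = op_part q c f + op_part q c g" for q f g
    using is_endo_op_part[OF assms(3)] unfolding is_endo_iff by blast
  then show ?thesis
    by (simp add: super_bracket_def op_part_add fun_eq_iff op_scale_def lessThan_2
        grassmann.scale_right_distrib algebra_simps)
qed

lemma super_bracket_add_right:
  assumes "is_endo a" "is_endo b" "is_endo c"
  shows "super_bracket c (a + b) = super_bracket c a + super_bracket c b"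
proof -
  have "op_part q c (f + g) = op_part q c f + op_part q c g" for q f g
    using is_endo_op_part[OF assms(3)] unfolding is_endo_iff by blast
  then show ?thesis
    by (simp add: super_bracket_def op_part_add fun_eq_iff op_scale_def lessThan_2
        grassmann.scale_right_distrib algebra_simps)
qed

lemma super_bracket_scale_left:
  assumes "is_endo a" "is_endo b"
  shows "super_bracket (op_scale c a) b = op_scale c (super_bracket a b)"
proof -
  have "op_part q b (grassmann_scale c f) = grassmann_scale c (op_part q b f)" for q f
    using is_endo_op_part[OF assms(2)] unfolding is_endo_iff by blast
  then show ?thesis
    unfolding super_bracket_def op_part_scale
    by (simp add: fun_eq_iff op_scale_def lessThan_2
        grassmann.scale_right_distrib grassmann.scale_right_diff_distrib)
qed

lemma super_bracket_scale_right:
  assumes "is_endo a" "is_endo b"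
  shows "super_bracket a (op_scale c b) = op_scale c (super_bracket a b)"
proof -
  have "op_part q a (grassmann_scale c f) = grassmann_scale c (op_part q a f)" for q f
    using is_endo_op_part[OF assms(1)] unfolding is_endo_iff by blast
  then show ?thesis
    unfolding super_bracket_def op_part_scale
    by (simp add: fun_eq_iff op_scale_def lessThan_2
        grassmann.scale_right_distrib grassmann.scale_right_diff_distrib)
qed

text \<open>Allows the pivot of smaller index to be put first in a bracket of monomials.\<close>

lemma super_bracket_commute:
  fixes a b :: "'k::field grassmann \<Rightarrow> 'k grassmann"
  assumes "is_endo a" "is_endo b" "p < 2" "q < 2" "op_part p a = a" "op_part q b = b"
  shows "super_bracket b a = op_scale (- ((-1) ^ (p * q))) (super_bracket a b)"
proof -
  have "(-1) ^ (p * q) * (-1) ^ (p * q) = (1 :: 'k)"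
    by (simp flip: power_mult_distrib)
  then show ?thesis
    unfolding super_bracket_homogeneous[OF assms] super_bracket_homogeneous[OF assms(2,1,4,3,6,5)]
    by (simp add: fun_eq_iff op_scale_def mult.commute[of q p] grassmann.scale_right_diff_distrib)
qed

lemma is_endo_scale: "is_endo a \<Longrightarrow> is_endo (op_scale c a)"
  using op.subspace_scale[OF subspace_is_endo] by blast


section \<open>Commutation relations of pivot elements\<close>

lemma partial_partial: "partial i (partial j f) = - partial j (partial i (f :: 'k::field grassmann))"
proof (rule grassmann_eqI)
  fix S :: "nat set" assume S: "finite S"
  show "coeff (partial i (partial j f)) S = coeff (- partial j (partial i f)) S"
  proof (cases "i = j \<or> i \<in> S \<or> j \<in> S")
    case False
    have "grassmann_sign {a} (insert b S) = (grassmann_sign {a} {b} * grassmann_sign {a} S :: 'k)"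
      if "b \<notin> S" for a b
      using grassmann_sign_Un_right[of "{a}" "{b}" S] S that by simp
    moreover have "grassmann_sign {i} {j} = (- grassmann_sign {j} {i} :: 'k)"
      using grassmann_sign_commute[of "{j}" "{i}"] False by auto
    ultimately show ?thesis using False by (simp add: insert_commute mult_ac)
  qed auto
qed

lemma partial_add: "partial i (f + g) = partial i f + partial i g"
  using is_endo_partial[of i] unfolding is_endo_iff by blast

lemma partial_sum: "finite A \<Longrightarrow> partial i (\<Sum>k\<in>A. F k) = (\<Sum>k\<in>A. partial i (F k))"
  by (induction A rule: finite_induct) (simp_all add: partial_add is_endo_0[OF is_endo_partial])

text \<open>All indices occurring in \<open>pivot m\<close> exceed \<open>n\<close>, so the
  derivative passes the even blocks freely and anticommutes with the partial derivatives.\<close>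

lemma partial_pivot:
  fixes f :: "'k::field grassmann"
  assumes "n < m"
  shows "partial n (pivot m f) = - pivot m (partial n f)"
proof -
  obtain N where N: "\<And>i h. i \<ge> N \<Longrightarrow> h \<in> {f, partial n f} \<Longrightarrow> partial i h = 0"
    using partial_eventually_0_finite[of "{f, partial n f}"] by blast
  have piv: "pivot m h = (\<Sum>k<N. grassmann_basis {m..<m + 2 * k} * partial (m + 2 * k) h)"
    if "h \<in> {f, partial n f}" for h
    by (rule pivot_eq_basis) (use that N in blast)
  have "partial n (grassmann_basis {m..<m + 2 * k} * partial (m + 2 * k) f) =
      - (grassmann_basis {m..<m + 2 * k} * partial (m + 2 * k) (partial n f))" for k
    using assms by (simp add: partial_leibniz[OF parity_part_block] partial_basis partial_partial[of n])
  then show ?thesis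
    by (simp add: piv partial_sum sum_negf)
qed

lemma parity_part_gen: "parity_part 1 (gen i) = gen i"
  using parity_part_basis[of "{i}"] by (simp add: gen_def)

lemma parity_part_gen_mult_gen: "parity_part 0 (gen i * gen j) = gen i * gen j"
  using parity_part_mult[OF parity_part_gen parity_part_gen, of i j] by simp

lemma pivot_leibniz_gen: "pivot m (gen i * f) = pivot m (gen i) * f - gen i * pivot m f"
  by (simp add: pivot_leibniz[OF parity_part_gen])

lemma pivot_leibniz_gen2:
  "pivot m (gen i * gen j * f) = pivot m (gen i * gen j) * f + gen i * gen j * pivot m f"
  by (simp add: pivot_leibniz[OF parity_part_gen_mult_gen])

lemma gen_mult_eq_0: "gen i * gen j * gen i = 0"
  by (simp add: gen_anticommute[of i j] mult.assoc gen_square)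

text \<open>Expand \<open>v_n\<close> as \<open>\<partial>_n + g v_{n+2}\<close> with
  \<open>g = x_n x_{n+1}\<close>. The two pure squares vanish, and in the mixed terms everything
  cancels by \<open>partial_pivot\<close> except the derivative of \<open>g\<close>.\<close>

lemma pivot_square:
  fixes f :: "'k::field grassmann"
  shows "pivot n (pivot n f) = gen (n + 1) * pivot (n + 2) f"
proof -
  let ?g = "gen n * gen (n + 1) :: 'k grassmann" and ?v = "pivot (n + 2)"
  have g: "partial n ?g = gen (n + 1)"
    by (simp add: partial_leibniz[OF parity_part_gen] partial_gen)
  have "?v ?g = 0" by (simp add: pivot_leibniz_gen pivot_gen_less)
  then have vg: "?v (?g * h) = ?g * ?v h" for h
    by (simp add: pivot_leibniz_gen2)
  have gg: "?g * (?g * h) = 0" for h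
  proof -
    have "?g * (?g * h) = gen n * gen (n + 1) * gen n * (gen (n + 1) * h)"
      by (simp only: mult.assoc)
    then show ?thesis by (simp only: gen_mult_eq_0 mult_zero_left)
  qed
  have dd: "partial n (partial n f) = 0"
    by (rule grassmann_eqI) simp
  have "pivot n (pivot n f) = partial n (partial n f + ?g * ?v f) + ?g * ?v (partial n f + ?g * ?v f)"
    by (simp only: pivot_rec[of n])
  also have "\<dots> = gen (n + 1) * ?v f + ?g * (partial n (?v f) + ?v (partial n f))"
    by (simp only: partial_add pivot_add dd vg gg partial_leibniz[OF parity_part_gen_mult_gen] g distrib_left)
       (simp add: algebra_simps)
  also have "\<dots> = gen (n + 1) * ?v f"
    by (simp add: partial_pivot)
  finally show ?thesis .
qed

text \<open>Only \<open>v_n\<close> is expanded by its recursion. This reduces the pair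
  \<open>(n, m)\<close> to \<open>(n + 2, m)\<close>, at the cost of a term in which
  \<open>v_m\<close> differentiates \<open>x_n x_{n+1}\<close>.\<close>

lemma pivot_anticommutator_step:
  fixes f :: "'k::field grassmann"
  assumes "n < m"
  shows "pivot n (pivot m f) + pivot m (pivot n f) =
    pivot m (gen n * gen (n + 1)) * pivot (n + 2) f +
    gen n * gen (n + 1) * (pivot (n + 2) (pivot m f) + pivot m (pivot (n + 2) f))"
  using partial_pivot[OF assms, of f]
  by (simp add: pivot_rec[of n] pivot_add pivot_leibniz_gen2 distrib_left del: add_2_eq_Suc')

lemma pivot_anticommutator_Suc:
  fixes f :: "'k::field grassmann"
  shows "pivot n (pivot (n + 1) f) + pivot (n + 1) (pivot n f) = - (gen n * pivot (n + 2) f)"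
proof -
  have v: "pivot (i + 1) (gen i * gen (i + 1)) = (- gen i :: 'k grassmann)" for i
    by (simp add: pivot_leibniz_gen pivot_gen_less pivot_gen_same)
  \<comment> \<open>A second use of the reduction, now for the pair \<open>(n + 1, n + 2)\<close>,
    exposes a factor \<open>x_{n+1}\<close>; the prefactor \<open>x_n x_{n+1}\<close> annihilates
    it, so the recursion stops.\<close>
  have "pivot (n + 2) (pivot (n + 1) f) + pivot (n + 1) (pivot (n + 2) f) =
      gen (n + 1) * (- pivot (n + 3) f +
        gen (n + 2) * (pivot (n + 3) (pivot (n + 2) f) + pivot (n + 2) (pivot (n + 3) f)))"
    using pivot_anticommutator_step[of "n + 1" "n + 2" f] v[of "n + 1"]
    by (simp add: algebra_simps eval_nat_numeral)
  then have "gen n * gen (n + 1) * (pivot (n + 2) (pivot (n + 1) f) + pivot (n + 1) (pivot (n + 2) f)) = 0"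
    by (simp add: mult.assoc) (simp add: gen_square flip: mult.assoc)
  then show ?thesis
    using pivot_anticommutator_step[of n "n + 1" f] v[of n] by simp
qed

text \<open>Induction on half the index gap, each step contributing a factor
  \<open>x_n x_{n+1}\<close>. With \<open>m = n + 2 * k + j\<close>, the inserted index is
  \<open>m + 1\<close> for \<open>j = 0\<close> and \<open>m - 1\<close> for
  \<open>j = 1\<close>.\<close>

lemma pivot_anticommutator:
  assumes "j < 2"
  shows "\<exists>c. \<forall>f :: 'k::field grassmann. pivot n (pivot (n + 2 * k + j) f) + pivot (n + 2 * k + j) (pivot n f) =
    grassmann_scale c (grassmann_basis (insert (n + 2 * k + 1 - j) {n..<n + 2 * k}) * pivot (n + 2 * k + 2) f)"
proof (induction k arbitrary: n)
  case 0
  show ?case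
  proof (cases "j = 0")
    case True
    \<comment> \<open>For equal indices the anticommutator is twice the square, so the scalar is 2,
      which is zero in characteristic 2.\<close>
    have "pivot n (pivot n f) + pivot n (pivot n f) =
        grassmann_scale 2 (grassmann_basis {n + 1} * pivot (n + 2) f)" for f :: "'k grassmann"
      unfolding pivot_square gen_def
      by (simp only: one_add_one[symmetric] grassmann.scale_left_distrib grassmann.scale_one)
    then show ?thesis using True by auto
  next
    case False
    then have j: "j = 1" using assms by simp
    have "pivot n (pivot (n + 1) f) + pivot (n + 1) (pivot n f) =
        grassmann_scale (- 1) (grassmann_basis {n} * pivot (n + 2) f)" for f :: "'k grassmann"
      unfolding pivot_anticommutator_Suc by (simp add: gen_def)
    then show ?thesis unfolding j by (intro exI[of _ "- 1"]) auto
  qed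
next
  case (Suc k)
  let ?m = "n + 2 * Suc k + j" and ?g = "gen n * gen (n + 1) :: 'k grassmann"
  let ?U = "insert (n + 2 + 2 * k + 1 - j) {n + 2..<n + 2 + 2 * k}"
  obtain c where c: "pivot (n + 2) (pivot ?m f) + pivot ?m (pivot (n + 2) f) =
      grassmann_scale c (grassmann_basis ?U * pivot (n + 2 * Suc k + 2) f)" for f :: "'k grassmann"
    using Suc[of "n + 2"] by (auto simp: algebra_simps)
  \<comment> \<open>Here \<open>?m\<close> is at least \<open>n + 2\<close>, so both letters of
    \<open>?g\<close> lie below it and the extra term of the reduction disappears.\<close>
  have "pivot ?m ?g = 0" by (simp add: pivot_leibniz_gen pivot_gen_less)
  moreover have "n < ?m" by simp
  ultimately have "pivot n (pivot ?m f) + pivot ?m (pivot n f) =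
      grassmann_scale c (?g * grassmann_basis ?U * pivot (n + 2 * Suc k + 2) f)" for f
    using pivot_anticommutator_step[of n ?m f]
    by (simp only: c mult_zero_left add_0 grassmann_scale_mult_right mult.assoc)
  moreover have "?g * grassmann_basis ?U = grassmann_scale (grassmann_sign {n..<n + 2} ?U)
      (grassmann_basis (insert (n + 2 * Suc k + 1 - j) {n..<n + 2 * Suc k}))"
  proof -
    have "?g = grassmann_basis {n..<n + 2}"
      by (simp add: upt_rec flip: prod_list_gen_upt)
    moreover have "{n..<n + 2} \<union> ?U = insert (n + 2 * Suc k + 1 - j) {n..<n + 2 * Suc k}"
      using assms by auto
    moreover have "{n..<n + 2} \<inter> ?U = {}" using assms by auto
    ultimately show ?thesis
      using grassmann_basis_mult[of "{n..<n + 2}" ?U, where 'k = 'k] by (simp only: finite_insert finite_atLeastLessThan)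
  qed
  ultimately have "pivot n (pivot ?m f) + pivot ?m (pivot n f) =
      grassmann_scale (c * grassmann_sign {n..<n + 2} ?U)
      (grassmann_basis (insert (n + 2 * Suc k + 1 - j) {n..<n + 2 * Suc k}) * pivot (n + 2 * Suc k + 2) f)" for f
    by (simp only: grassmann_scale_mult_left grassmann.scale_scale)
  then show ?case by blast
qed

section \<open>Monomials in front of a pivot element, and their brackets\<close>

definition pivot_monomial :: "nat set \<Rightarrow> nat \<Rightarrow> 'k::field grassmann \<Rightarrow> 'k grassmann" where
  "pivot_monomial S m = (\<lambda>f. grassmann_basis S * pivot m f)"

lemma is_endo_pivot_monomial: "is_endo (pivot_monomial S m)"
  by (simp add: is_endo_iff pivot_monomial_def pivot_add pivot_scale distrib_left grassmann_scale_mult_right)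

lemma op_part_pivot_monomial: "op_part (Suc (card S) mod 2) (pivot_monomial S m) = pivot_monomial S m"
proof (rule op_part_eq_selfI[OF is_endo_pivot_monomial])
  fix q and f :: "'a grassmann" assume "q < 2" "parity_part q f = f"
  then have "parity_part ((1 + q) mod 2) (pivot m f) = pivot m f"
    by (intro parity_part_apply[OF is_endo_pivot pivot_odd])
  note parity_part_mult[OF parity_part_basis this, of S]
  moreover have "(Suc (card S) mod 2 + q) mod 2 = (card S mod 2 + (1 + q) mod 2) mod 2"
    by (simp only: mod_add_left_eq mod_add_right_eq) simp
  ultimately show "parity_part ((Suc (card S) mod 2 + q) mod 2) (pivot_monomial S m f) = pivot_monomial S m f"
    by (simp only: pivot_monomial_def)
qed simp

text \<open>By the Leibniz rule a bracket has terms in which a coefficient is differentiated and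
  terms with two pivots. The assumption removes the derivative of \<open>e_S\<close>; commuting
  \<open>e_T\<close> past \<open>e_S\<close> collects the two-pivot terms into an
  anticommutator.\<close>

lemma super_bracket_pivot_monomial:
  fixes f :: "'k::field grassmann"
  assumes "pivot m (grassmann_basis S) = (0 :: 'k grassmann)"
  shows "super_bracket (pivot_monomial S n) (pivot_monomial T m) f =
    grassmann_basis S * pivot n (grassmann_basis T) * pivot m f +
    (-1) ^ card T * (grassmann_basis S * grassmann_basis T * (pivot n (pivot m f) + pivot m (pivot n f)))"
proof -
  let ?S = "grassmann_basis S :: 'k grassmann" and ?T = "grassmann_basis T :: 'k grassmann"
    and ?s = "card S mod 2" and ?t = "card T mod 2"
  have 1: "super_bracket (pivot_monomial S n) (pivot_monomial T m) f =
      ?S * pivot n (?T * pivot m f) -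
      (-1) ^ ((Suc (card S) mod 2) * (Suc (card T) mod 2)) * (?T * pivot m (?S * pivot n f))"
    using super_bracket_homogeneous[OF is_endo_pivot_monomial is_endo_pivot_monomial _ _
        op_part_pivot_monomial op_part_pivot_monomial, of S T n m, where 'a = 'k]
    by (simp only: pos_mod_bound zero_less_numeral mod_less_divisor simp_thms op_scale_def
        grassmann_scale_minus_one_power pivot_monomial_def fun_diff_def comp_apply)
  have 2: "pivot n (?T * pivot m f) = pivot n ?T * pivot m f + (-1) ^ ?t * (?T * pivot n (pivot m f))"
    by (rule pivot_leibniz[OF parity_part_basis])
  have 3: "pivot m (?S * pivot n f) = (-1) ^ ?s * (?S * pivot m (pivot n f))"
    using pivot_leibniz[OF parity_part_basis, of m S "pivot n f"] by (simp only: assms mult_zero_left add_0)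
  have 4: "Suc (card S) mod 2 = 1 - ?s" "Suc (card T) mod 2 = 1 - ?t"
    by presburger+
  have 5: "?T * (?S * h) = (-1) ^ (?s * ?t) * (?S * (?T * h))" for h
    using grassmann_supercommute[OF parity_part_basis parity_part_basis, of T S, where 'k = 'k]
    by (simp only: mult.assoc[symmetric] mult.commute[of "?s"])
  have 6: "(-1) ^ card T = ((-1) ^ ?t :: 'k grassmann)"
    by (cases "even (card T)") (simp_all add: even_iff_mod_2_eq_zero odd_iff_mod_2_eq_one)
  \<comment> \<open>The signs agree in each of the four parity cases.\<close>
  have "?s = 0 \<or> ?s = 1" "?t = 0 \<or> ?t = 1" by linarith+
  then show ?thesis
    unfolding 1 2 3 4 6 by (elim disjE) (simp_all add: 5 distrib_left right_diff_distrib mult.assoc)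
qed


section \<open>Standard monomials and weights\<close>

text \<open>The pair of top letters has to be excluded because \<open>x_{m-2} x_{m-1} v_m\<close>
  has the same weight as \<open>v_{m-2}\<close>. The form \<open>i + 2 \<noteq> m\<close> avoids
  truncated subtraction.\<close>

definition standard :: "nat set \<Rightarrow> nat \<Rightarrow> bool" where
  "standard S m \<longleftrightarrow> S \<subseteq> {..<m} \<and> (\<forall>i. i \<in> S \<and> Suc i \<in> S \<longrightarrow> i + 2 \<noteq> m)"

text \<open>The second component is needed only to separate \<open>e\<^sub>A v\<^sub>p\<close> from \<open>e\<^bsub>A \<union> {p}\<^esub> v\<^bsub>p+1\<^esub>\<close>.\<close>

definition weight :: "nat set \<Rightarrow> nat \<Rightarrow> int \<times> int" where
  "weight S m = (2 ^ m - (\<Sum>i\<in>S. 2 ^ i), (-1) ^ m - (\<Sum>i\<in>S. (-1) ^ i))"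

lemma standard_finite: "standard S m \<Longrightarrow> finite S"
  unfolding standard_def using finite_subset by blast

lemma sum_power2_less: "S \<subseteq> {..<m} \<Longrightarrow> (\<Sum>i\<in>S. 2 ^ i) < (2 ^ m :: int)"
proof -
  assume S: "S \<subseteq> {..<m}"
  have "(\<Sum>i\<in>S. 2 ^ i) \<le> (\<Sum>i<m. 2 ^ i :: int)"
    using S by (intro sum_mono2) auto
  also have "\<dots> < 2 ^ m" by (induction m) auto
  finally show ?thesis .
qed

text \<open>Since \<open>S\<close> omits \<open>m - 1\<close>, the value lies above
  \<open>2 ^ (m - 1)\<close> (for positive \<open>m\<close>) and is at most \<open>2 ^ m\<close>.
  These ranges are disjoint, which recovers \<open>m\<close>; uniqueness of binary expansions then
  recovers \<open>S\<close>.\<close>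

lemma power2_minus_sum_inj:
  assumes S: "S \<subseteq> {i. Suc i < m}" and T: "T \<subseteq> {i. Suc i < n}"
    and eq: "2 ^ m - (\<Sum>i\<in>S. 2 ^ i) = (2 ^ n - (\<Sum>i\<in>T. 2 ^ i) :: int)"
  shows "S = T \<and> m = n"
proof -
  have *: "2 ^ q < 2 ^ Suc q - (\<Sum>i\<in>A. 2 ^ i :: int)" if "A \<subseteq> {i. Suc i < Suc q}" for A q
    using sum_power2_less[of A q] that by auto
  have le: "\<not> q < p" if A: "A \<subseteq> {i. Suc i < p}"
      and e: "2 ^ p - (\<Sum>i\<in>A. 2 ^ i) = (2 ^ q - (\<Sum>i\<in>B. 2 ^ i) :: int)" for A B p q
  proof
    assume "q < p"
    then obtain r where r: "p = Suc r" "q \<le> r" by (metis Suc_leI le_Suc_ex less_imp_Suc_add le_add1)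
    have "(2 :: int) ^ q \<le> 2 ^ r" using r by simp
    moreover have "(\<Sum>i\<in>B. 2 ^ i :: int) \<ge> 0" by (intro sum_nonneg) auto
    ultimately show False using *[OF A[unfolded r(1)]] e[unfolded r(1)] by (simp only: power_Suc)
  qed
  have mn: "m = n" using le[OF S eq] le[OF T eq[symmetric]] by linarith
  then have "int (\<Sum>i\<in>S. 2 ^ i) = int (\<Sum>i\<in>T. 2 ^ i)" using eq by simp
  then have "set_encode S = set_encode T" by (simp only: set_encode_def of_nat_eq_iff)
  moreover have "finite S" by (rule finite_subset[of _ "{..<m}"]) (use S in auto)
  moreover have "finite T" by (rule finite_subset[of _ "{..<n}"]) (use T in auto)
  ultimately show ?thesis using mn by (simp add: set_encode_eq)
qed

text \<open>If \<open>p = m - 1\<close> lies in \<open>S\<close>, then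
  \<open>2 ^ (p + 1) - 2 ^ p = 2 ^ p\<close> turns the first component into that of
  \<open>S - {p}\<close> with pivot \<open>p\<close>. Hence the first component leaves at most two
  candidates, and the second tells them apart.\<close>

lemma weight_inj:
  assumes S: "standard S m" and T: "standard T n" and eq: "weight S m = weight T n"
  shows "S = T \<and> m = n"
proof -
  have red: "\<exists>A p. A \<subseteq> {i. Suc i < p} \<and> fst (weight B q) = 2 ^ p - (\<Sum>i\<in>A. 2 ^ i) \<and>
      (B = A \<and> q = p \<and> snd (weight B q) = (-1) ^ p - (\<Sum>i\<in>A. (-1) ^ i) \<or>
       B = insert p A \<and> q = Suc p \<and> snd (weight B q) = -2 * (-1) ^ p - (\<Sum>i\<in>A. (-1) ^ i))"
    if B: "standard B q" for B q
  proof (cases "\<exists>p. q = Suc p \<and> p \<in> B")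
    case True
    then obtain p where p: "q = Suc p" "p \<in> B" by blast
    define A where "A = B - {p}"
    have A: "A \<subseteq> {i. Suc i < p}"
    proof
      fix i assume i: "i \<in> A"
      then have "i < p" "i \<in> B" using B p unfolding standard_def A_def by auto
      \<comment> \<open>This is where the exclusion of two top letters enters: \<open>p\<close> is
        in \<open>B\<close>, so \<open>p - 1\<close> is not.\<close>
      moreover have "Suc i \<noteq> p" using B p \<open>i \<in> B\<close> unfolding standard_def by auto
      ultimately show "i \<in> {i. Suc i < p}" by auto
    qed
    have BA: "B = insert p A" "p \<notin> A" "finite A"
      using p standard_finite[OF B] by (auto simp: A_def)
    show ?thesis
      by (intro exI[of _ A] exI[of _ p]) (use A BA in \<open>simp add: weight_def p(1)\<close>)
  next
    case False
    have "B \<subseteq> {i. Suc i < q}"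
    proof
      fix i assume "i \<in> B"
      then show "i \<in> {i. Suc i < q}"
        using B False unfolding standard_def by (metis Suc_lessI lessThan_iff mem_Collect_eq subsetD)
    qed
    then show ?thesis
      by (intro exI[of _ B] exI[of _ q]) (simp add: weight_def)
  qed
  obtain A p where A: "A \<subseteq> {i. Suc i < p}" "fst (weight S m) = 2 ^ p - (\<Sum>i\<in>A. 2 ^ i)"
      "S = A \<and> m = p \<and> snd (weight S m) = (-1) ^ p - (\<Sum>i\<in>A. (-1) ^ i) \<or>
       S = insert p A \<and> m = Suc p \<and> snd (weight S m) = -2 * (-1) ^ p - (\<Sum>i\<in>A. (-1) ^ i)"
    using red[OF S] by blast
  obtain B q where B: "B \<subseteq> {i. Suc i < q}" "fst (weight T n) = 2 ^ q - (\<Sum>i\<in>B. 2 ^ i)"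
      "T = B \<and> n = q \<and> snd (weight T n) = (-1) ^ q - (\<Sum>i\<in>B. (-1) ^ i) \<or>
       T = insert q B \<and> n = Suc q \<and> snd (weight T n) = -2 * (-1) ^ q - (\<Sum>i\<in>B. (-1) ^ i)"
    using red[OF T] by blast
  have AB: "A = B" "p = q" using power2_minus_sum_inj[OF A(1) B(1)] A(2) B(2) eq by auto
  \<comment> \<open>The two candidates have different second components, as these differ by
    \<open>3 * (-1) ^ q\<close>.\<close>
  have "(-1) ^ q \<noteq> -2 * (-1 :: int) ^ q" by (cases "even q") auto
  then show ?thesis using A(3) B(3) eq unfolding AB by auto
qed

definition of_weight :: "int \<times> int \<Rightarrow> ('k::field grassmann \<Rightarrow> 'k grassmann) \<Rightarrow> bool" where
  "of_weight w a \<longleftrightarrow> a = 0 \<or> (\<exists>S m c. standard S m \<and> weight S m = w \<and> a = op_scale c (pivot_monomial S m))"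

section \<open>Brackets and squares of operators of given weight\<close>

lemma is_endo_of_weight: "of_weight w a \<Longrightarrow> is_endo a"
  using op.subspace_0[OF subspace_is_endo] is_endo_scale[OF is_endo_pivot_monomial]
  unfolding of_weight_def by blast

lemma of_weight_scale: "of_weight w a \<Longrightarrow> of_weight w (op_scale c a)"
  unfolding of_weight_def by (metis op.scale_scale op.scale_zero_right)

lemma weight_Un:
  "finite S \<Longrightarrow> finite T \<Longrightarrow> S \<inter> T = {} \<Longrightarrow>
    weight (S \<union> T) m = weight S m - ((\<Sum>i\<in>T. 2 ^ i), (\<Sum>i\<in>T. (-1) ^ i))"
  by (simp add: weight_def sum.union_disjoint)

lemma sum_power2_block: "(\<Sum>i\<in>{n..<n + k}. 2 ^ i) = (2 ^ (n + k) - 2 ^ n :: int)"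
  by (induction k) auto

lemma sum_minus_one_power_block: "(\<Sum>i\<in>{n..<n + 2 * k}. (-1) ^ i) = (0 :: int)"
  by (induction k) auto

text \<open>The first term of the bracket formula. Applying \<open>v_n\<close> to \<open>e_T\<close>
  trades the letter \<open>n + 2 * k\<close> for the block from \<open>n\<close> to
  \<open>n + 2 * k - 1\<close>, which changes the weight by exactly
  \<open>(2 ^ n, (-1) ^ n)\<close>.\<close>

lemma derivative_of_weight:
  fixes S T :: "nat set"
  assumes S: "standard S n" and T: "standard T m" and nm: "n \<le> m"
    and k: "n + 2 * k \<in> T" "T \<inter> {n..<n + 2 * k} = {}"
  shows "of_weight (weight S n + weight T m) (\<lambda>f :: 'k::field grassmann.
    grassmann_basis S * pivot n (grassmann_basis T) * pivot m f)"
proof -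
  let ?I = "{n..<n + 2 * k}" and ?R = "T - {n + 2 * k}"
  have fin: "finite S" "finite T" and sub: "S \<subseteq> {..<n}" "T \<subseteq> {..<m}"
    using S T standard_finite by (auto simp: standard_def)
  obtain c where c: "pivot n (grassmann_basis T) = grassmann_scale (c :: 'k) (grassmann_basis (?I \<union> ?R))"
    using pivot_basis[OF fin(2) k] by blast
  show ?thesis
  proof (cases "S \<inter> (?I \<union> ?R) = {}")
    case False
    then show ?thesis
      by (simp add: c grassmann_scale_mult_right grassmann_basis_mult_eq_0 of_weight_def zero_fun_def)
  next
    case True
    let ?U = "S \<union> (?I \<union> ?R)"
    have "(\<lambda>f :: 'k grassmann. grassmann_basis S * pivot n (grassmann_basis T) * pivot m f) =
        op_scale (c * grassmann_sign S (?I \<union> ?R)) (pivot_monomial ?U m)"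
      using True fin
      by (simp add: c grassmann_scale_mult_right grassmann_scale_mult_left grassmann_basis_mult
          op_scale_def pivot_monomial_def)
    moreover have "standard ?U m"
      unfolding standard_def
    proof (intro conjI allI impI notI)
      show "?U \<subseteq> {..<m}" using sub nm k(1) by auto
    next
      fix i assume i: "i \<in> ?U \<and> Suc i \<in> ?U" and m: "i + 2 = m"
      \<comment> \<open>The block and \<open>S\<close> stay below \<open>n + 2 * k\<close>, so if
        both top letters occurred they would come from \<open>T\<close>, which is standard.\<close>
      have "n + 2 * k < m" using k(1) sub by auto
      then have "Suc i \<in> T" "Suc i \<noteq> n + 2 * k" using i m sub by auto
      then have "i \<in> T" using i m sub \<open>n + 2 * k < m\<close> by auto
      then show False using T m \<open>Suc i \<in> T\<close> unfolding standard_def by blast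
    qed
    moreover have "weight ?U m = weight S n + weight T m"
    proof -
      have "T = ?R \<union> {n + 2 * k}" using k(1) by blast
      then have "weight T m = weight ?R m - (2 ^ (n + 2 * k), (-1) ^ (n + 2 * k))"
        using weight_Un[of ?R "{n + 2 * k}" m] fin by auto
      moreover have "weight ?U m = weight (?I \<union> ?R) m - ((\<Sum>i\<in>S. 2 ^ i), (\<Sum>i\<in>S. (-1) ^ i))"
        using weight_Un[of "?I \<union> ?R" S m] fin True by (simp add: Int_commute Un_commute)
      moreover have "weight (?I \<union> ?R) m = weight ?R m - ((\<Sum>i\<in>?I. 2 ^ i), (\<Sum>i\<in>?I. (-1) ^ i))"
        using weight_Un[of ?R ?I m] fin k(2) by (simp add: Un_commute Diff_Int_distrib2)
      ultimately show ?thesis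
        by (simp add: weight_def[of S] sum_power2_block sum_minus_one_power_block power_add power_mult)
    qed
    ultimately show ?thesis unfolding of_weight_def by blast
  qed
qed

text \<open>The second term of the bracket formula. The new pivot has index
  \<open>p = n + 2 * k + 2\<close>, and exactly one of the letters \<open>p - 1\<close> (for
  \<open>j = 0\<close>) and \<open>p - 2\<close> (for \<open>j = 1\<close>) occurs, so a nonzero
  result is standard.\<close>

lemma anticommutator_of_weight:
  fixes S T :: "nat set"
  assumes S: "standard S n" and T: "standard T m" and m: "m = n + 2 * k + j" "j < 2"
  shows "of_weight (weight S n + weight T m) (\<lambda>f :: 'k::field grassmann. grassmann_basis S * grassmann_basis T *
      (grassmann_basis (insert (n + 2 * k + 1 - j) {n..<n + 2 * k}) * pivot (n + 2 * k + 2) f))"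
proof -
  let ?U = "insert (n + 2 * k + 1 - j) {n..<n + 2 * k}" and ?p = "n + 2 * k + 2"
  have fin: "finite S" "finite T" and sub: "S \<subseteq> {..<n}" "T \<subseteq> {..<m}"
    using S T standard_finite by (auto simp: standard_def)
  show ?thesis
  proof (cases "S \<inter> T = {} \<and> (S \<union> T) \<inter> ?U = {}")
    case False
    then have "grassmann_basis S * grassmann_basis T * grassmann_basis ?U = (0 :: 'k grassmann)"
      using fin grassmann_basis_mult_eq_0[of S T, where 'k = 'k] grassmann_basis_mult_eq_0[of "S \<union> T" ?U, where 'k = 'k]
      by (cases "S \<inter> T = {}") (auto simp: grassmann_basis_mult grassmann_scale_mult_left)
    then show ?thesis by (simp add: of_weight_def zero_fun_def flip: mult.assoc)
  next
    case True
    have "(\<lambda>f :: 'k grassmann. grassmann_basis S * grassmann_basis T * (grassmann_basis ?U * pivot ?p f)) =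
        op_scale (grassmann_sign S T * grassmann_sign (S \<union> T) ?U) (pivot_monomial (S \<union> T \<union> ?U) ?p)"
      using True fin
      by (simp add: grassmann_scale_mult_left grassmann_basis_mult op_scale_def pivot_monomial_def
          flip: mult.assoc del: insert_is_Un Un_insert_right)
    moreover have "standard (S \<union> T \<union> ?U) ?p"
      using m sub unfolding standard_def by (auto simp: less_2_cases_iff)
    moreover have "weight (S \<union> T \<union> ?U) ?p = weight S n + weight T m"
    proof -
      have "weight (S \<union> T \<union> ?U) ?p = weight (S \<union> T) ?p - ((\<Sum>i\<in>?U. 2 ^ i), (\<Sum>i\<in>?U. (-1) ^ i))"
        using fin True by (intro weight_Un) auto
      also have "weight (S \<union> T) ?p = weight S ?p - ((\<Sum>i\<in>T. 2 ^ i), (\<Sum>i\<in>T. (-1) ^ i))"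
        using fin True by (intro weight_Un) auto
      finally show ?thesis
        using m(2) unfolding m(1)
        by (auto simp: weight_def less_2_cases_iff sum_power2_block sum_minus_one_power_block power_add power_mult)
    qed
    ultimately show ?thesis unfolding of_weight_def by blast
  qed
qed

text \<open>The two terms of the bracket formula never survive together: if \<open>v_n\<close> does
  not kill \<open>e_T\<close>, then \<open>T\<close> shares a letter with the anticommutator. So a
  single monomial remains.\<close>

lemma super_bracket_of_weight_le:
  fixes S T :: "nat set"
  assumes S: "standard S n" and T: "standard T m" and nm: "n \<le> m"
  shows "of_weight (weight S n + weight T m)
    (super_bracket (pivot_monomial S n) (pivot_monomial T m) :: 'k::field grassmann \<Rightarrow> 'k grassmann)"
proof -
  let ?S = "grassmann_basis S :: 'k grassmann" and ?T = "grassmann_basis T :: 'k grassmann"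
  have fin: "finite S" "finite T" and sub: "S \<subseteq> {..<n}" "T \<subseteq> {..<m}"
    using S T standard_finite by (auto simp: standard_def)
  define k where "k = (m - n) div 2"
  define j where "j = (m - n) mod 2"
  have m: "m = n + 2 * k + j" "j < 2" using nm by (auto simp: k_def j_def)
  obtain c where c: "pivot n (pivot m f) + pivot m (pivot n f) =
      grassmann_scale c (grassmann_basis (insert (n + 2 * k + 1 - j) {n..<n + 2 * k}) * pivot (n + 2 * k + 2) f)"
    for f :: "'k grassmann"
    using pivot_anticommutator[OF m(2), of n k] unfolding m(1) by blast
  have "pivot m ?S = 0" using sub nm by (intro pivot_basis_eq_0) auto
  then have formula: "super_bracket (pivot_monomial S n) (pivot_monomial T m) =
      (\<lambda>f. ?S * pivot n ?T * pivot m f +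
        (-1) ^ card T * (?S * ?T * (pivot n (pivot m f) + pivot m (pivot n f))))"
    by (intro ext super_bracket_pivot_monomial)
  show ?thesis
  proof (cases "\<exists>l. n + 2 * l \<in> T \<and> T \<inter> {n..<n + 2 * l} = {}")
    case True
    then obtain l where l: "n + 2 * l \<in> T" "T \<inter> {n..<n + 2 * l} = {}" by blast
    \<comment> \<open>The letter lies below \<open>m\<close>, hence in the block, except when
      \<open>j = 1\<close> and \<open>l = k\<close>; then it is the inserted index.\<close>
    then have "n + 2 * l \<in> insert (n + 2 * k + 1 - j) {n..<n + 2 * k}"
      using m sub by (cases "l < k") (auto simp: less_2_cases_iff)
    then have "?T * grassmann_basis (insert (n + 2 * k + 1 - j) {n..<n + 2 * k}) = 0"
      using l(1) by (intro grassmann_basis_mult_eq_0) blast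
    then have "?S * ?T * (pivot n (pivot m f) + pivot m (pivot n f)) = 0" for f
      unfolding c grassmann_scale_mult_right mult.assoc
      unfolding mult.assoc[symmetric, of ?T]
      by simp
    then have "super_bracket (pivot_monomial S n) (pivot_monomial T m) = (\<lambda>f. ?S * pivot n ?T * pivot m f)"
      unfolding formula by simp
    then show ?thesis
      using derivative_of_weight[OF S T nm l, where 'k = 'k] by simp
  next
    case False
    then have "pivot n ?T = 0" by (intro pivot_basis_eq_0) blast
    then have "super_bracket (pivot_monomial S n) (pivot_monomial T m) =
        op_scale ((-1) ^ card T * c) (\<lambda>f. ?S * ?T *
          (grassmann_basis (insert (n + 2 * k + 1 - j) {n..<n + 2 * k}) * pivot (n + 2 * k + 2) f))"
      unfolding formula c op_scale_def grassmann_scale_minus_one_power[symmetric] grassmann_scale_mult_right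
      by (simp add: mult.commute)
    then show ?thesis
      using of_weight_scale[OF anticommutator_of_weight[OF S T m, where 'k = 'k]] by simp
  qed
qed

lemma super_bracket_of_weight:
  fixes a b :: "'k::field grassmann \<Rightarrow> 'k grassmann"
  assumes "of_weight v a" "of_weight w b"
  shows "of_weight (v + w) (super_bracket a b)"
proof (cases "a = 0 \<or> b = 0")
  case True
  have "is_endo a" "is_endo b" using assms by (simp_all add: is_endo_of_weight)
  then have "super_bracket a b = 0"
    using True super_bracket_scale_left[of a b 0] super_bracket_scale_right[of a b 0] by auto
  then show ?thesis by (simp add: of_weight_def)
next
  case False
  obtain S m c where S: "standard S m" "weight S m = v" "a = op_scale c (pivot_monomial S m)"
    using assms(1) False unfolding of_weight_def by blast
  obtain T n d where T: "standard T n" "weight T n = w" "b = op_scale d (pivot_monomial T n)"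
    using assms(2) False unfolding of_weight_def by blast
  have *: "of_weight (v + w) (super_bracket (pivot_monomial S m) (pivot_monomial T n :: 'k grassmann \<Rightarrow> 'k grassmann))"
  proof (cases "m \<le> n")
    case True
    then show ?thesis using super_bracket_of_weight_le[OF S(1) T(1)] S(2) T(2) by simp
  next
    case False
    then have "of_weight (v + w) (super_bracket (pivot_monomial T n) (pivot_monomial S m :: 'k grassmann \<Rightarrow> 'k grassmann))"
      using super_bracket_of_weight_le[OF T(1) S(1)] S(2) T(2) by (simp add: add.commute)
    then show ?thesis
      using super_bracket_commute[OF is_endo_pivot_monomial is_endo_pivot_monomial _ _
          op_part_pivot_monomial op_part_pivot_monomial, of T S m n, where 'k = 'k]
      by (simp add: of_weight_scale del: op.scale_minus_left)
  qed
  show ?thesis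
    unfolding S(3) T(3)
    by (simp add: super_bracket_scale_left super_bracket_scale_right is_endo_scale is_endo_pivot_monomial
        of_weight_scale *)
qed

text \<open>For nonempty \<open>S\<close> the square vanishes, since \<open>v_m\<close> kills
  \<open>e_S\<close> and \<open>e_S\<close> squares to zero. For empty \<open>S\<close> it is a
  multiple of \<open>x_{m+1} v_{m+2}\<close>.\<close>

lemma square_of_weight:
  fixes a :: "'k::field grassmann \<Rightarrow> 'k grassmann"
  assumes "of_weight w a"
  shows "of_weight (w + w) (a \<circ> a)"
proof (cases "a = 0")
  case True
  then show ?thesis by (simp add: of_weight_def fun_eq_iff)
next
  case False
  then obtain S m c where S: "standard S m" "weight S m = w" "a = op_scale c (pivot_monomial S m)"
    using assms unfolding of_weight_def by blast
  have "a \<circ> a = op_scale (c * c) (pivot_monomial S m \<circ> pivot_monomial S m)"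
    unfolding S(3)
    by (simp add: fun_eq_iff op_scale_def pivot_monomial_def pivot_scale grassmann_scale_mult_right)
  moreover have "of_weight (w + w) (pivot_monomial S m \<circ> pivot_monomial S m :: 'k grassmann \<Rightarrow> 'k grassmann)"
  proof (cases "S = {}")
    case True
    have "pivot_monomial S m \<circ> pivot_monomial S m = (pivot_monomial {m + 1} (m + 2) :: 'k grassmann \<Rightarrow> 'k grassmann)"
      unfolding True
      by (simp add: fun_eq_iff pivot_monomial_def pivot_square gen_def flip: one_grassmann_def)
    moreover have "standard {m + 1} (m + 2)" by (simp add: standard_def)
    moreover have "weight {m + 1} (m + 2) = w + w"
      unfolding S(2)[symmetric] True by (simp add: weight_def)
    ultimately show ?thesis unfolding of_weight_def by (metis op.scale_one)
  next
    case False
    have "pivot m (grassmann_basis S) = (0 :: 'k grassmann)"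
      using S(1) by (intro pivot_basis_eq_0) (auto simp: standard_def)
    then have "grassmann_basis S * pivot m (grassmann_basis S * pivot m f) = 0" for f :: "'k grassmann"
    proof -
      assume "pivot m (grassmann_basis S) = (0 :: 'k grassmann)"
      then have "grassmann_basis S * pivot m (grassmann_basis S * pivot m f) =
          (-1) ^ (card S mod 2) * (grassmann_basis S * grassmann_basis S * pivot m (pivot m f))"
        using pivot_leibniz[OF parity_part_basis, of m S "pivot m f"]
        by (cases "even (card S)") (simp_all add: even_iff_mod_2_eq_zero odd_iff_mod_2_eq_one mult.assoc)
      then show ?thesis using False by (simp add: grassmann_basis_mult_eq_0)
    qed
    then show ?thesis by (simp add: of_weight_def fun_eq_iff pivot_monomial_def)
  qed
  ultimately show ?thesis by (simp add: of_weight_scale)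
qed

section \<open>Multidegrees as weights\<close>

definition degree_weight :: "nat \<times> nat \<Rightarrow> int \<times> int" where
  "degree_weight n = (int (fst n) + 2 * int (snd n), int (fst n) - int (snd n))"

lemma degree_weight_add: "degree_weight (m + n) = degree_weight m + degree_weight n"
  by (simp add: degree_weight_def)

text \<open>The weights \<open>(1, 1)\<close> of \<open>v_0\<close> and \<open>(2, -1)\<close> of
  \<open>v_1\<close> are linearly independent.\<close>

lemma degree_weight_inj: "degree_weight m = degree_weight n \<Longrightarrow> m = n"
  by (auto simp: degree_weight_def prod_eq_iff)

lemma lie_monomial_of_weight: "lie_monomial n a \<Longrightarrow> of_weight (degree_weight n) a"
proof (induction rule: lie_monomial.induct)
  case gen0
  have "standard {} 0" "weight {} 0 = degree_weight (1, 0)" "pivot 0 = op_scale 1 (pivot_monomial {} 0)"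
    by (simp_all add: standard_def weight_def degree_weight_def pivot_monomial_def op_scale_def flip: one_grassmann_def)
  then show ?case unfolding of_weight_def by blast
next
  case gen1
  have "standard {} 1" "weight {} 1 = degree_weight (0, 1)" "pivot 1 = op_scale 1 (pivot_monomial {} 1)"
    by (simp_all add: standard_def weight_def degree_weight_def pivot_monomial_def op_scale_def flip: one_grassmann_def)
  then show ?case unfolding of_weight_def by blast
next
  case (bracket m a n b)
  then show ?case by (simp add: degree_weight_add super_bracket_of_weight)
next
  case (square n a)
  then show ?case by (simp only: degree_weight_add square_of_weight)
qed


section \<open>The gradation\<close>

text \<open>By \<open>weight_inj\<close> both operators are multiples of the same standard monomial.
  This is the source of the dimension bound.\<close>

lemma of_weight_proportional:
  assumes "of_weight w a" "of_weight w b" "a \<noteq> 0"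
  shows "\<exists>c. b = op_scale c a"
proof (cases "b = 0")
  case True
  then show ?thesis by (metis op.scale_zero_left)
next
  case False
  obtain S m c where S: "standard S m" "weight S m = w" "a = op_scale c (pivot_monomial S m)"
    using assms unfolding of_weight_def by blast
  obtain T n d where T: "standard T n" "weight T n = w" "b = op_scale d (pivot_monomial T n)"
    using assms(2) False unfolding of_weight_def by blast
  have "T = S \<and> n = m" using weight_inj[OF T(1) S(1)] S(2) T(2) by simp
  moreover have "c \<noteq> 0" using S(3) assms(3) by auto
  ultimately have "b = op_scale (d / c) a" using S(3) T(3) by simp
  then show ?thesis by blast
qed

text \<open>Closure under addition is not formal: it needs proportionality of the two
  summands.\<close>

lemma subspace_of_weight: "op.subspace {a :: 'k::field grassmann \<Rightarrow> 'k grassmann. of_weight w a}"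
proof (rule op.subspaceI)
  fix a b :: "'k grassmann \<Rightarrow> 'k grassmann" assume "a \<in> {a. of_weight w a}" "b \<in> {a. of_weight w a}"
  then have ab: "of_weight w a" "of_weight w b" by simp_all
  show "a + b \<in> {a. of_weight w a}"
  proof (cases "a = 0")
    case False
    then obtain c where "b = op_scale c a" using of_weight_proportional[OF ab] by blast
    then have "a + b = op_scale (1 + c) a" by (simp add: op.scale_left_distrib)
    then show ?thesis using of_weight_scale[OF ab(1)] by simp
  qed (use ab in simp)
qed (auto simp: of_weight_scale, simp add: of_weight_def)

lemma pivot_component_of_weight: "a \<in> pivot_component n \<Longrightarrow> of_weight (degree_weight n) a"
  using op.span_minimal[OF _ subspace_of_weight, of "{a. lie_monomial n a}" "degree_weight n"] lie_monomial_of_weight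
  unfolding pivot_component_def by blast

lemma is_endo_lie_monomial: "lie_monomial n a \<Longrightarrow> is_endo a"
  using lie_monomial_of_weight is_endo_of_weight by blast

lemma subspace_pivot_component: "op.subspace (pivot_component n)"
  unfolding pivot_component_def by (rule op.subspace_span)

lemma lie_monomial_pivot_component: "lie_monomial n a \<Longrightarrow> a \<in> pivot_component n"
  unfolding pivot_component_def by (auto intro: op.span_base)

lemma sum_fun_apply: "(\<Sum>i\<in>A. F i) x = (\<Sum>i\<in>A. F i x)"
  by (induction A rule: infinite_finite_induct) simp_all

text \<open>Evaluate at the generator of least pivot index \<open>m n\<close>. Summands of larger
  pivot index vanish there, and the others give multiples of basis elements \<open>e_{S l}\<close>,
  which are distinct because the weights are.\<close>

lemma of_weight_sum_eq_0:
  fixes d :: "nat \<times> nat \<Rightarrow> 'k::field grassmann \<Rightarrow> 'k grassmann"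
  assumes "finite W" and d: "\<And>n. n \<in> W \<Longrightarrow> of_weight (degree_weight n) (d n) \<and> d n \<noteq> 0"
    and sum: "(\<Sum>n\<in>W. d n) = 0"
  shows "W = {}"
proof (rule ccontr)
  assume "W \<noteq> {}"
  have "\<forall>n\<in>W. \<exists>S m c. standard S m \<and> weight S m = degree_weight n \<and> d n = op_scale c (pivot_monomial S m)"
    using d unfolding of_weight_def by blast
  then obtain S m c where S: "\<And>n. n \<in> W \<Longrightarrow> standard (S n) (m n)"
      "\<And>n. n \<in> W \<Longrightarrow> weight (S n) (m n) = degree_weight n"
      "\<And>n. n \<in> W \<Longrightarrow> d n = op_scale (c n) (pivot_monomial (S n) (m n))"
    by metis
  obtain n where n: "n \<in> W" "\<And>l. l \<in> W \<Longrightarrow> m n \<le> m l"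
    using \<open>finite W\<close> \<open>W \<noteq> {}\<close> by (metis arg_min_if_finite(1) arg_min_least)
  have coeff: "coeff (d l (gen (m n))) (S n) = (if l = n then c n else 0)" if l: "l \<in> W" for l
  proof (cases "m l = m n")
    case True
    have "S l = S n \<Longrightarrow> l = n"
      using S(2)[OF l] S(2)[OF n(1)] True degree_weight_inj by metis
    then show ?thesis
      using True standard_finite[OF S(1)[OF l]]
      by (auto simp: S(3)[OF l] op_scale_def pivot_monomial_def pivot_gen_same coeff_basis)
  next
    case False
    then have "m n < m l" using n(2)[OF l] by simp
    then show ?thesis
      using False by (auto simp: S(3)[OF l] op_scale_def pivot_monomial_def pivot_gen_less)
  qed
  have "0 = coeff ((\<Sum>l\<in>W. d l) (gen (m n))) (S n)"
    unfolding sum by simp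
  also have "\<dots> = (\<Sum>l\<in>W. if l = n then c n else 0)"
    unfolding sum_fun_apply coeff_sum by (intro sum.cong refl coeff)
  also have "\<dots> = c n" using n(1) \<open>finite W\<close> by simp
  finally show False using S(3)[OF n(1)] d[OF n(1)] by simp
qed

text \<open>Bilinearity of the bracket is available only for endomorphisms, so the subspaces in the
  proof carry \<open>is_endo\<close> along.\<close>

lemma super_bracket_span:
  assumes X: "\<And>a. a \<in> X \<Longrightarrow> is_endo a" and Y: "\<And>b. b \<in> Y \<Longrightarrow> is_endo b" and Z: "op.subspace Z"
    and XY: "\<And>a b. a \<in> X \<Longrightarrow> b \<in> Y \<Longrightarrow> super_bracket a b \<in> Z"
    and a: "a \<in> op.span X" and b: "b \<in> op.span Y"
  shows "super_bracket a b \<in> Z"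
proof -
  have endo: "is_endo x" if "x \<in> op.span V" "\<And>v. v \<in> V \<Longrightarrow> is_endo v" for x V
    using op.span_minimal[OF _ subspace_is_endo, of V] that by blast
  have "op.subspace {x. is_endo x \<and> super_bracket x y \<in> Z}" if "is_endo y" for y
  proof (rule op.subspaceI)
    show "0 \<in> {x. is_endo x \<and> super_bracket x y \<in> Z}"
      using super_bracket_scale_left[OF that that, of 0] op.subspace_0[OF Z] op.subspace_0[OF subspace_is_endo] by simp
  qed (use that Z op.subspace_add[OF subspace_is_endo] op.subspace_scale[OF subspace_is_endo] in
      \<open>auto simp: super_bracket_add_left super_bracket_scale_left op.subspace_add op.subspace_scale\<close>)
  note left = op.span_minimal[OF _ this]
  have "op.subspace {y. is_endo y \<and> super_bracket x y \<in> Z}" if "is_endo x" for x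
  proof (rule op.subspaceI)
    show "0 \<in> {y. is_endo y \<and> super_bracket x y \<in> Z}"
      using super_bracket_scale_right[OF that that, of 0] op.subspace_0[OF Z] op.subspace_0[OF subspace_is_endo] by simp
  qed (use that Z op.subspace_add[OF subspace_is_endo] op.subspace_scale[OF subspace_is_endo] in
      \<open>auto simp: super_bracket_add_right super_bracket_scale_right op.subspace_add op.subspace_scale\<close>)
  note right = op.span_minimal[OF _ this]
  have "op.span Y \<subseteq> {y. is_endo y \<and> super_bracket x y \<in> Z}" if "x \<in> X" for x
    by (rule right) (use X[OF that] XY[OF that] Y in auto)
  then have "op.span X \<subseteq> {x. is_endo x \<and> super_bracket x b \<in> Z}"
    by (intro left) (use X endo[OF b Y] b in auto)
  then show ?thesis using a by blast
qed

section \<open>Lie monomials span the generated superalgebra\<close>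

lemma op_part_0: "op_part p 0 = 0"
  by (simp add: op_part_def fun_eq_iff)

lemma op_part_of_weight:
  assumes "of_weight w a" "p < 2"
  shows "op_part p a = a \<or> op_part p a = 0"
proof (cases "a = 0")
  case True
  then show ?thesis by (simp add: op_part_0)
next
  case False
  then obtain S m c where a: "a = op_scale c (pivot_monomial S m)"
    using assms(1) unfolding of_weight_def by blast
  have "op_part p (op_part (Suc (card S) mod 2) (pivot_monomial S m)) =
      (if p = Suc (card S) mod 2 then op_part p (pivot_monomial S m) else 0)"
    by (rule op_part_op_part[OF is_endo_pivot_monomial assms(2)]) simp
  then have "op_part p (pivot_monomial S m) = pivot_monomial S m \<or> op_part p (pivot_monomial S m) = 0"
    by (metis op_part_pivot_monomial)
  then show ?thesis unfolding a op_part_scale by (metis op.scale_zero_right)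
qed

lemma lie_monomial_span: "lie_monomial n a \<Longrightarrow> a \<in> op.span {a. \<exists>n. lie_monomial n a}"
  by (rule op.span_base) blast

lemma lie_superalgebra_span_lie_monomials:
  "lie_superalgebra (op.span {a :: 'k::field grassmann \<Rightarrow> 'k grassmann. \<exists>n. lie_monomial n a})"
proof -
  let ?M = "{a :: 'k grassmann \<Rightarrow> 'k grassmann. \<exists>n. lie_monomial n a}"
  let ?V = "op.span ?M"
  have endo: "?V \<subseteq> {a. is_endo a}"
    using is_endo_lie_monomial by (intro op.span_minimal subspace_is_endo) blast
  have bracket: "super_bracket a b \<in> ?V" if "a \<in> ?V" "b \<in> ?V" for a b
    by (rule super_bracket_span[OF _ _ op.subspace_span _ that])
       (use is_endo_lie_monomial lie_monomial_span lie_monomial.bracket in blast)+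
  have part_lie: "op_part p a = a \<or> op_part p a = 0" if "lie_monomial n a" "p < 2"
    for p n and a :: "'k grassmann \<Rightarrow> 'k grassmann"
    using op_part_of_weight[OF lie_monomial_of_weight[OF that(1)] that(2)] .
  have part: "op_part p a \<in> ?V" if "a \<in> ?V" "p < 2" for a p
    using that(1)
  proof (induction rule: op.span_induct_alt)
    case base
    then show ?case by (simp only: op_part_0 op.span_zero)
  next
    case (step k x y)
    then obtain n where n: "lie_monomial n x" by blast
    have "op_part p x \<in> ?V"
      using part_lie[OF n that(2)] lie_monomial_span[OF n] op.span_zero[of ?M] by auto
    then show ?case
      using step unfolding op_part_add op_part_scale by (intro op.span_add op.span_scale)
  qed
  \<comment> \<open>Partial sums of an odd element need not be odd, so the induction squares the odd
    part. Membership in \<open>?V\<close> is included because the induction step uses it for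
    \<open>y\<close>.\<close>
  have square: "a \<in> ?V \<and> op_part 1 a \<circ> op_part 1 a \<in> ?V" if "a \<in> ?V" and char: "CHAR('k) = 2" for a
    using that(1)
  proof (induction rule: op.span_induct_alt)
    case base
    have "(0 :: 'k grassmann \<Rightarrow> 'k grassmann) \<circ> 0 = (0 :: 'k grassmann \<Rightarrow> 'k grassmann)" by (simp add: fun_eq_iff)
    then show ?case by (simp only: op_part_0 op.span_zero simp_thms)
  next
    case (step k x y)
    obtain n where n: "lie_monomial n x" using step by blast
    have xV: "x \<in> ?V" using n by (rule lie_monomial_span)
    have endos: "is_endo x" "is_endo y" using xV step endo by auto
    let ?x = "op_part 1 x" and ?y = "op_part 1 y"
    have yV: "?y \<in> ?V" using part step by simp
    have xy: "is_endo ?x" "is_endo ?y" "?x \<in> ?V"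
      using endos part[OF xV] by (simp_all add: is_endo_op_part)
    have xx: "?x \<circ> ?x \<in> ?V"
    proof (cases "?x = x")
      case True
      then have "lie_monomial (n + n) (x \<circ> x)"
        using n char by (intro lie_monomial.square) (auto simp: odd_op_def)
      then show ?thesis unfolding True by (rule lie_monomial_span)
    next
      case False
      then have "?x = 0" using part_lie[OF n, of 1] by simp
      then show ?thesis using op.span_zero[of ?M] by (simp add: zero_fun_def comp_def)
    qed
    have "super_bracket ?x ?y = (?x \<circ> ?y) + (?y \<circ> ?x)"
      using super_bracket_homogeneous[OF xy(1,2), of 1 1] endos by (simp add: op_part_op_part)
    then have anti: "(?x \<circ> ?y) + (?y \<circ> ?x) \<in> ?V"
      using bracket[OF xy(3) yV] by (simp only:)
    \<comment> \<open>Squaring is not additive, but the cross terms form the bracket of two odd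
      elements.\<close>
    have expand: "op_part 1 (op_scale k x + y) \<circ> op_part 1 (op_scale k x + y) =
        op_scale (k * k) (?x \<circ> ?x) + op_scale k ((?x \<circ> ?y) + (?y \<circ> ?x)) + (?y \<circ> ?y)"
      using xy(1,2) unfolding is_endo_iff op_part_add op_part_scale
      by (simp add: op_scale_def fun_eq_iff grassmann.scale_right_distrib algebra_simps)
    show ?case
      unfolding expand
      by (intro conjI op.span_add op.span_scale xV xx anti conjunct1[OF step(2)] conjunct2[OF step(2)])
  qed
  show ?thesis
    unfolding lie_superalgebra_def
  proof (intro conjI ballI allI impI endo op.subspace_span part bracket)
    fix a assume "CHAR('k) = 2" "a \<in> ?V" "odd_op a"
    then show "a \<circ> a \<in> ?V" using square unfolding odd_op_def by fastforce
  qed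
qed

lemma lie_monomial_pivot_algebra: "lie_monomial n a \<Longrightarrow> a \<in> pivot_algebra"
proof (induction rule: lie_monomial.induct)
  case (bracket m a n b)
  then show ?case using lie_superalgebra_pivot_algebra(1) unfolding lie_superalgebra_def by blast
next
  case (square n a)
  then show ?case using lie_superalgebra_pivot_algebra(1) unfolding lie_superalgebra_def by blast
qed (rule lie_superalgebra_pivot_algebra)+

lemma pivot_algebra_subset: "pivot_algebra \<subseteq> op.span {a. \<exists>n. lie_monomial n a}"
  unfolding pivot_algebra_def
  using lie_superalgebra_span_lie_monomials
    lie_monomial_span[OF lie_monomial.gen0] lie_monomial_span[OF lie_monomial.gen1]
  by (intro Inter_lower) simp

section \<open>The components as a direct sum decomposition\<close>

lemma pivot_component_subset: "pivot_component n \<subseteq> pivot_algebra"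
  unfolding pivot_component_def
proof (rule op.span_minimal)
  show "{a. lie_monomial n a} \<subseteq> pivot_algebra" using lie_monomial_pivot_algebra by blast
  show "op.subspace pivot_algebra" using lie_superalgebra_pivot_algebra(1) unfolding lie_superalgebra_def by blast
qed

lemma decomposition_exists:
  assumes "a \<in> pivot_algebra"
  shows "\<exists>c. finite {n. c n \<noteq> 0} \<and> (\<forall>n. c n \<in> pivot_component n) \<and> a = (\<Sum>n | c n \<noteq> 0. c n)"
proof -
  have "a \<in> op.span {a. \<exists>n. lie_monomial n a}" using assms pivot_algebra_subset by blast
  \<comment> \<open>Supports can shrink when summands cancel, so the induction uses any finite
    \<open>A\<close> containing the support and cuts it down afterwards.\<close>
  then have "\<exists>c A. finite A \<and> (\<forall>n. n \<notin> A \<longrightarrow> c n = 0) \<and> (\<forall>n. c n \<in> pivot_component n) \<and> a = (\<Sum>n\<in>A. c n)"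
  proof (induction rule: op.span_induct_alt)
    case base
    show ?case
      using op.subspace_0[OF subspace_pivot_component]
      by (intro exI[of _ "\<lambda>_. 0"] exI[of _ "{}"]) (auto simp: zero_fun_def)
  next
    case (step k x y)
    then obtain n c A where x: "lie_monomial n x" and c: "finite A" "\<forall>n. n \<notin> A \<longrightarrow> c n = 0"
        "\<forall>n. c n \<in> pivot_component n" "y = (\<Sum>n\<in>A. c n)" by blast
    have "y = (\<Sum>m\<in>insert n A. c m)"
      unfolding c(4) using c(1,2) by (intro sum.mono_neutral_left) auto
    define e where "e m = (if m = n then op_scale k x else 0) + c m" for m
    have "op_scale k x + y = (\<Sum>m\<in>insert n A. e m)"
      unfolding e_def using c(1) \<open>y = (\<Sum>m\<in>insert n A. c m)\<close>
      by (simp add: sum.distrib del: sum.insert_if sum.insert)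
    moreover have "e m \<in> pivot_component m" for m
      unfolding e_def using c(3)[rule_format, of m] lie_monomial_pivot_component[OF x]
      by (intro op.subspace_add[OF subspace_pivot_component])
         (simp_all add: op.subspace_0[OF subspace_pivot_component] op.subspace_scale[OF subspace_pivot_component])
    moreover have "\<forall>m. m \<notin> insert n A \<longrightarrow> e m = 0" using c(2) by (simp add: e_def)
    ultimately show ?case
      using c(1) by (intro exI[of _ e] exI[of _ "insert n A"]) blast
  qed
  then obtain c A where c: "finite A" "\<forall>n. n \<notin> A \<longrightarrow> c n = 0" "\<forall>n. c n \<in> pivot_component n" "a = (\<Sum>n\<in>A. c n)"
    by blast
  have sub: "{n. c n \<noteq> 0} \<subseteq> A" using c(2) by blast
  then have "a = (\<Sum>n | c n \<noteq> 0. c n)"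
    unfolding c(4) using c(1) by (intro sum.mono_neutral_right) auto
  then show ?thesis using sub c finite_subset by blast
qed

text \<open>The differences of corresponding components keep their weights and sum to zero, so
  independence of distinct weights applies to the nonzero ones.\<close>

lemma decomposition_unique:
  assumes c: "finite {n. c n \<noteq> 0}" "\<forall>n. c n \<in> pivot_component n"
    and d: "finite {n. d n \<noteq> 0}" "\<forall>n. d n \<in> pivot_component n"
    and eq: "(\<Sum>n | c n \<noteq> 0. c n) = (\<Sum>n | d n \<noteq> 0. d n)"
  shows "c = d"
proof -
  let ?A = "{n. c n \<noteq> 0} \<union> {n. d n \<noteq> 0}" and ?W = "{n. c n - d n \<noteq> 0}"
  have W: "?W \<subseteq> ?A" by auto
  have "(\<Sum>n\<in>?W. c n - d n) = (\<Sum>n\<in>?A. c n - d n)"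
    using c(1) d(1) W by (intro sum.mono_neutral_left) auto
  also have "\<dots> = (\<Sum>n\<in>?A. c n) - (\<Sum>n\<in>?A. d n)" by (rule sum_subtractf)
  also have "(\<Sum>n\<in>?A. c n) = (\<Sum>n | c n \<noteq> 0. c n)"
    using c(1) d(1) by (intro sum.mono_neutral_right) auto
  also have "(\<Sum>n\<in>?A. d n) = (\<Sum>n | d n \<noteq> 0. d n)"
    using c(1) d(1) by (intro sum.mono_neutral_right) auto
  finally have "(\<Sum>n\<in>?W. c n - d n) = 0" by (simp only: eq diff_self)
  moreover have "of_weight (degree_weight n) (c n - d n)" for n
    using c(2)[rule_format, of n] d(2)[rule_format, of n]
    by (intro pivot_component_of_weight op.subspace_diff[OF subspace_pivot_component])
  moreover have "finite ?W" using W c(1) d(1) finite_subset by blast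
  ultimately have "?W = {}" by (intro of_weight_sum_eq_0) auto
  then show ?thesis by auto
qed

text \<open>Since the component is at most a line, \<open>a\<close> is a multiple of a single Lie
  monomial \<open>b\<close>; oddness passes to \<open>b\<close>, and the squaring rule applies to
  it.\<close>

lemma square_pivot_component:
  fixes a :: "'k::field grassmann \<Rightarrow> 'k grassmann"
  assumes char: "CHAR('k) = 2" and a: "a \<in> pivot_component n" "odd_op a"
  shows "a \<circ> a \<in> pivot_component (n + n)"
proof (cases "a = 0")
  case True
  then have "a \<circ> a = 0" by (simp add: fun_eq_iff)
  then show ?thesis using op.subspace_0[OF subspace_pivot_component] by simp
next
  case False
  have "\<exists>b :: 'k grassmann \<Rightarrow> 'k grassmann. lie_monomial n b \<and> b \<noteq> 0"
  proof (rule ccontr)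
    assume "\<not> ?thesis"
    then have "pivot_component n \<subseteq> op.span {0 :: 'k grassmann \<Rightarrow> 'k grassmann}"
      unfolding pivot_component_def by (intro op.span_mono) blast
    then show False using a False by auto
  qed
  then obtain b :: "'k grassmann \<Rightarrow> 'k grassmann" where b: "lie_monomial n b" "b \<noteq> 0" by blast
  obtain k where k: "a = op_scale k b"
    using of_weight_proportional[OF lie_monomial_of_weight[OF b(1)] pivot_component_of_weight[OF a(1)] b(2)] by blast
  have "op_scale k (op_part 1 b) = op_scale k b"
    using a(2) unfolding odd_op_def k op_part_scale .
  then have "odd_op b" using False k unfolding odd_op_def by auto
  then have "b \<circ> b \<in> pivot_component (n + n)"
    by (intro lie_monomial_pivot_component lie_monomial.square char b(1))
  moreover have "a \<circ> a = op_scale (k * k) (b \<circ> b)"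
    using is_endo_lie_monomial[OF b(1)] unfolding k is_endo_iff by (simp add: op_scale_def fun_eq_iff)
  ultimately show ?thesis using op.subspace_scale[OF subspace_pivot_component] by simp
qed

text \<open>Any nonzero element spans its component by \<open>of_weight_proportional\<close>; the
  zero component has the empty basis.\<close>

lemma pivot_component_basis:
  "\<exists>B :: ('k::field grassmann \<Rightarrow> 'k grassmann) set.
    finite B \<and> card B \<le> 1 \<and> op.independent B \<and> op.span B = pivot_component n"
proof (cases "\<exists>a :: 'k grassmann \<Rightarrow> 'k grassmann. a \<in> pivot_component n \<and> a \<noteq> 0")
  case False
  then have "op.span {} = (pivot_component n :: ('k grassmann \<Rightarrow> 'k grassmann) set)"
    using op.subspace_0[OF subspace_pivot_component, of n] unfolding op.span_empty by blast
  then show ?thesis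
    using op.independent_empty by (intro exI[of _ "{}"] conjI) auto
next
  case True
  then obtain a :: "'k grassmann \<Rightarrow> 'k grassmann" where a: "a \<in> pivot_component n" "a \<noteq> 0" by blast
  show ?thesis
  proof (intro exI[of _ "{a}"] conjI)
    show "op.independent {a}" using a(2) by (simp only: op.dependent_single not_False_eq_True)
    show "op.span {a} = pivot_component n"
    proof
      show "op.span {a} \<subseteq> pivot_component n"
        using a by (intro op.span_minimal subspace_pivot_component) blast
      show "pivot_component n \<subseteq> op.span {a}"
      proof
        fix b :: "'k grassmann \<Rightarrow> 'k grassmann" assume b: "b \<in> pivot_component n"
        obtain k where "b = op_scale k a"
          using of_weight_proportional[OF pivot_component_of_weight[OF a(1)] pivot_component_of_weight[OF b] a(2)]
          by blast
        then show "b \<in> op.span {a}" using op.span_scale[OF op.span_base[of a "{a}"]] by blast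
      qed
    qed
  qed auto
qed

theorem theorem8p4:
  "is_gradation (pivot_algebra :: ('k::field grassmann \<Rightarrow> 'k grassmann) set) pivot_component \<and>
   (\<forall>n. \<exists>B :: ('k grassmann \<Rightarrow> 'k grassmann) set.
      finite B \<and> card B \<le> 1 \<and> op.independent B \<and> op.span B = pivot_component n)"
proof
  have bracket: "super_bracket a b \<in> pivot_component (m + n)"
    if "a \<in> pivot_component m" "b \<in> pivot_component n" for m n and a b :: "'k grassmann \<Rightarrow> 'k grassmann"
    by (rule super_bracket_span[OF _ _ subspace_pivot_component _ that[unfolded pivot_component_def]])
       (auto intro: is_endo_lie_monomial lie_monomial_pivot_component lie_monomial.bracket)
  have "\<exists>!c. finite {n. c n \<noteq> 0} \<and> (\<forall>n. c n \<in> pivot_component n) \<and> a = (\<Sum>n | c n \<noteq> 0. c n)"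
    if "a \<in> pivot_algebra" for a :: "'k grassmann \<Rightarrow> 'k grassmann"
    using decomposition_exists[OF that] decomposition_unique by (intro ex_ex1I) blast+
  then show "is_gradation (pivot_algebra :: ('k grassmann \<Rightarrow> 'k grassmann) set) pivot_component"
    unfolding is_gradation_def
    using subspace_pivot_component pivot_component_subset bracket square_pivot_component by blast
qed (use pivot_component_basis in blast)

end
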